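(* Let $\mathbf{S}$ be a canonical single-parameter exponential family with divergence $d(\cdot,\cdot)$, and let $\hat\pi_1$ be the KL-based confidence-interval policy with threshold $\beta(n,\delta)=3\log(1+\log n)+\mathcal{T}(\log(1/\delta))$. Then, for every $\nu\in\mathbf{S}$ with mean $\mu$, every cost distribution $\mathcal{C}$ with mean $0<\overline c<\infty$, and every budget $C_\delta\to\infty$ (as $\delta\to0$) for which $\lim_{\delta\to0}C_\delta/\log(1/\delta)$ exists in $[0,\infty]$: (a) $\hat\pi_1\in\hat\Pi^s_{\rm CI}$. (b) If $\lim_{\delta\to0}\frac{C_\delta}{\log(1/\delta)}=k$ with $k\in(0,\infty)$, then the limiting endpoints of $\hat\pi_1$ are $\mu_R^{\hat\pi_1}(\mu)=\mu_R^*(\mu,k,\overline c)$ and $\mu_L^{\hat\pi_1}(\mu)=\mu_L^*(\mu,k,\overline c)$, where $\mu_L^*(\mu,k,\overline c)<\mu$ and $\mu_R^*(\mu,k,\overline c)>\mu$ uniquely solve $d(\mu,\mu_R^*(\mu,k,\overline c))=d(\mu,\mu_L^*(\mu,k,\overline c))=\frac{\overline c}{k}$. (c) If $\lim_{\delta\to0}\frac{C_\delta}{\log(1/\delta)}=\infty$, then $\mu_R^{\hat\pi_1}(\mu)-\mu_L^{\hat\pi_1}(\mu)=0$.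
   Context: Exponential family. Fix a reference measure $\xi$ on $\mathbb{R}$. $\mathbf{S}=\{p_\theta:\theta\in\Theta\}$, with $\frac{dp_\theta}{d\xi}(x)=\exp(\theta x-b(\theta))$, where $\Theta=\{\theta\in\mathbb{R}:\int|x|e^{\theta x}\,d\xi(x)<\infty\}$ is assumed to be an open interval, and $b$ is a twice differentiable, strictly convex function. The mean of $p_\theta$ is $b'(\theta)$, strictly increasing in $\theta$; its inverse is $\mu\mapsto\theta(\mu)$. The set of means is the open interval $\mathbf{O}=(\underline\mu,\overline\mu)$ (endpoints possibly infinite). For $\mu,\tilde\mu\in\mathbf{O}$, $d(\mu,\tilde\mu)=KL(p_{\theta(\mu)},p_{\theta(\tilde\mu)})=b(\theta(\tilde\mu))-b(\theta(\mu))-b'(\theta(\mu))(\theta(\tilde\mu)-\theta(\mu))$. Equivalently $d(y,q)=\sup_{\lambda\in\mathbb{R}}\{\lambda y-\log\mathbb{E}_{p_{\theta(q)}}[e^{\lambda X}]\}$, and this formula defines $d(y,q)\in[0,\infty]$ for $q\in\mathbf{O}$ when $y\notin\mathbf{O}$. Random costs. $X_1,X_2,\dots$ are i.i.d. from $\nu$; the costs $c_1,c_2,\dots$ are i.i.d. from a distribution $\mathcal{C}$ supported on $(0,\infty)$ with mean $\overline c$, independent of the $X_i$. For a budget $C_\delta>0$, $\tau_\delta=\sup\{n\in\mathbb{Z}^+:\sum_{i=1}^nc_i\le C_\delta\}$ (with $\tau_\delta=0$ if the set is empty). $\mathbb{P}_\nu$ denotes the joint law of samples and costs. Policies and stability.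 A policy $\pi$ reports, for each $\delta\in(0,1)$, an interval $[\widehat\mu_L^\pi(\tau_\delta,\delta),\widehat\mu_R^\pi(\tau_\delta,\delta)]$ whose (extended-real) endpoints are measurable functions of $\tau_\delta$ and $X_1,\dots,X_{\tau_\delta}$. $\hat\Pi_{\rm CI}$ is the set of policies such that for every $\nu\in\mathbf{S}$ with mean $\mu$ and every $\delta\in(0,1)$, $\mathbb{P}_\nu(\mu\in[\widehat\mu_L^\pi(\tau_\delta,\delta),\widehat\mu_R^\pi(\tau_\delta,\delta)])\ge1-\delta$. A policy $\pi\in\hat\Pi_{\rm CI}$ is stable (for $\nu$ with mean $\mu$, $\mathcal{C}$ and $C_\delta$) if, as $\delta\to0$, under $\mathbb{P}_\nu$, $\widehat\mu_L^\pi(\tau_\delta,\delta)\overset{p}{\to}\mu_L^\pi(\mu)$ and $\widehat\mu_R^\pi(\tau_\delta,\delta)\overset{p}{\to}\mu_R^\pi(\mu)$, where $\mu_L^\pi(\mu)\le\mu\le\mu_R^\pi(\mu)$ are deterministic constants ($\pm\infty$ allowed), called the limiting endpoints. $\hat\Pi^s_{\rm CI}$ is the set of stable policies in $\hat\Pi_{\rm CI}$. Threshold. $\psi(u)=u-\ln u$ for $u\ge1$, with inverse $\psi^{-1}:[1,\infty)\to[1,\infty)$. With $y=3/2$, $\tilde\psi_y(x)=e^{1/\psi^{-1}(x)}\psi^{-1}(x)$ if $x\ge\psi^{-1}(1/\ln y)$, and $\tilde\psi_y(x)=y(x-\ln\ln y)$ otherwise (for $0\le x$). $\mathcal{T}(x)=2\tilde\psi_{3/2}\left(\frac{x+\log(2\zeta(2))}{2}\right)$,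 $\zeta(2)=\sum_{n\ge1}n^{-2}$. $\beta(n,\delta)=3\log(1+\log n)+\mathcal{T}(\log(1/\delta))$. Policy $\hat\pi_1$. With $\hat\mu_n=\frac1n\sum_{t=1}^nX_t$, for $n\ge1$, $\widehat\mu_R^{\hat\pi_1}(n,\delta)=\sup\{q\in\mathbf{O}:q>\hat\mu_n,\ n\,d(\hat\mu_n,q)\le\beta(n,\delta)\}$ and $\widehat\mu_L^{\hat\pi_1}(n,\delta)=\inf\{q\in\mathbf{O}:q<\hat\mu_n,\ n\,d(\hat\mu_n,q)\le\beta(n,\delta)\}$, each taken to be $\hat\mu_n$ if the corresponding set is empty; for $n=0$ the interval is $[\underline\mu,\overline\mu]$. The reported interval is evaluated at $n=\tau_\delta$.
   Formalization: In (b), on each side of μ separately, the unique solution and its identification as the limiting endpoint are asserted only if d(μ,·) reaches the level c̄/k on that side; in some families d(μ,·) is bounded there and no solution exists. *)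

theory Defs
  imports "HOL-Probability.Probability"
begin

section \<open>One-parameter exponential families\<close>

definition param_set :: "real measure \<Rightarrow> real set" where
  "param_set \<xi> = {\<theta>. integrable \<xi> (\<lambda>x. \<bar>x\<bar> * exp (\<theta> * x))}"

definition fam :: "real measure \<Rightarrow> (real \<Rightarrow> real) \<Rightarrow> real \<Rightarrow> real measure" where
  "fam \<xi> b \<theta> = density \<xi> (\<lambda>x. ennreal (exp (\<theta> * x - b \<theta>)))"

text \<open>Requiring every member to be a probability measure forces
  \<open>b \<theta> = ln (\<integral>x. exp (\<theta> * x) \<partial>\<xi>)\<close> on the parameter set;
  the values of \<open>b\<close> elsewhere are irrelevant.\<close>

definition exponential_family :: "real measure \<Rightarrow> (real \<Rightarrow> real) \<Rightarrow> bool" where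
  "exponential_family \<xi> b \<longleftrightarrow>
     sets \<xi> = sets borel \<and>
     open (param_set \<xi>) \<and> is_interval (param_set \<xi>) \<and>
     (\<forall>\<theta>\<in>param_set \<xi>. prob_space (fam \<xi> b \<theta>)) \<and>
     (\<forall>\<theta>\<in>param_set \<xi>. b differentiable (at \<theta>) \<and> deriv b differentiable (at \<theta>)) \<and>
     (\<forall>s\<in>param_set \<xi>. \<forall>t\<in>param_set \<xi>. \<forall>u\<in>{0<..<1}. s \<noteq> t \<longrightarrow>
        b (u * s + (1 - u) * t) < u * b s + (1 - u) * b t)"

definition family :: "real measure \<Rightarrow> (real \<Rightarrow> real) \<Rightarrow> real measure set" where
  "family \<xi> b = fam \<xi> b ` param_set \<xi>"

definition mean_of :: "real measure \<Rightarrow> real" where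
  "mean_of \<nu> = (\<integral>x. x \<partial>\<nu>)"

definition means :: "real measure \<Rightarrow> (real \<Rightarrow> real) \<Rightarrow> real set" where
  "means \<xi> b = mean_of ` family \<xi> b"

definition param_of_mean :: "real measure \<Rightarrow> (real \<Rightarrow> real) \<Rightarrow> real \<Rightarrow> real" where
  "param_of_mean \<xi> b = the_inv_into (param_set \<xi>) (\<lambda>\<theta>. mean_of (fam \<xi> b \<theta>))"

text \<open>Logarithmic moment generating function, infinite where the exponential moment is.\<close>

definition log_mgf :: "real measure \<Rightarrow> real \<Rightarrow> ereal" where
  "log_mgf \<nu> l =
     (if integrable \<nu> (\<lambda>x. exp (l * x)) then ereal (ln (\<integral>x. exp (l * x) \<partial>\<nu>)) else \<infinity>)"

text \<open>In the library, \<open>KL_divergence e M N\<close> is the divergence of \<open>N\<close> relative to \<open>M\<close>,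
  i.e. \<open>KL(N, M)\<close> in the usual notation; hence the order of the arguments. The first
  argument \<open>exp 1\<close> selects the natural logarithm. The function is meant for \<open>q \<in> means \<xi> b\<close>.\<close>

definition dvg :: "real measure \<Rightarrow> (real \<Rightarrow> real) \<Rightarrow> real \<Rightarrow> real \<Rightarrow> ereal" where
  "dvg \<xi> b y q =
     (if y \<in> means \<xi> b
      then ereal (KL_divergence (exp 1) (fam \<xi> b (param_of_mean \<xi> b q)) (fam \<xi> b (param_of_mean \<xi> b y)))
      else (SUP l. ereal (l * y) - log_mgf (fam \<xi> b (param_of_mean \<xi> b q)) l))"


section \<open>Samples, costs and the random sample size\<close>

definition cost_distribution :: "real measure \<Rightarrow> bool" where
  "cost_distribution C \<longleftrightarrow> prob_space C \<and> sets C = sets borel \<and> (AE c in C. 0 < c)"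

text \<open>Canonical joint law. For an outcome \<open>(x, c)\<close>, the \<open>(i+1)\<close>-st sample is \<open>x i\<close> and the
  \<open>(i+1)\<close>-st cost is \<open>c i\<close>; the first \<open>n\<close> of them are those with index in \<open>{..<n}\<close>.\<close>

definition joint_law :: "real measure \<Rightarrow> real measure \<Rightarrow> ((nat \<Rightarrow> real) \<times> (nat \<Rightarrow> real)) measure" where
  "joint_law \<nu> C = (\<Pi>\<^sub>M i\<in>UNIV. \<nu>) \<Otimes>\<^sub>M (\<Pi>\<^sub>M i\<in>UNIV. C)"

text \<open>The set below is almost surely finite, as the costs are i.i.d. and positive; the
  value \<open>0\<close> in the infinite case is a convention on a null set.\<close>

definition sample_size :: "real \<Rightarrow> (nat \<Rightarrow> real) \<Rightarrow> nat" where
  "sample_size B c =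
     (let N = {n. 1 \<le> n \<and> (\<Sum>i<n. c i) \<le> B} in if finite N \<and> N \<noteq> {} then Max N else 0)"


section \<open>Confidence-interval policies\<close>

text \<open>An endpoint rule maps \<open>n\<close>, \<open>\<delta>\<close> and the first \<open>n\<close> samples, given as an element of
  \<open>\<Pi>\<^sub>M i\<in>{..<n}. borel\<close>, to an extended real. A policy is a pair (left, right).\<close>

type_synonym endpoint = "nat \<Rightarrow> real \<Rightarrow> (nat \<Rightarrow> real) \<Rightarrow> ereal"
type_synonym policy = "endpoint \<times> endpoint"

definition is_policy :: "policy \<Rightarrow> bool" where
  "is_policy \<pi> \<longleftrightarrow>
     (\<forall>n. \<forall>\<delta>\<in>{0<..<1}.
        fst \<pi> n \<delta> \<in> borel_measurable (\<Pi>\<^sub>M i\<in>{..<n}. borel) \<and>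
        snd \<pi> n \<delta> \<in> borel_measurable (\<Pi>\<^sub>M i\<in>{..<n}. borel) \<and>
        (\<forall>x\<in>space (\<Pi>\<^sub>M i\<in>{..<n}. borel). fst \<pi> n \<delta> x \<le> snd \<pi> n \<delta> x))"

definition reported ::
    "endpoint \<Rightarrow> (real \<Rightarrow> real) \<Rightarrow> real \<Rightarrow> (nat \<Rightarrow> real) \<times> (nat \<Rightarrow> real) \<Rightarrow> ereal" where
  "reported e budget \<delta> \<omega> =
     (let n = sample_size (budget \<delta>) (snd \<omega>) in e n \<delta> (restrict (fst \<omega>) {..<n}))"

definition ci_policies ::
    "real measure \<Rightarrow> (real \<Rightarrow> real) \<Rightarrow> real measure \<Rightarrow> (real \<Rightarrow> real) \<Rightarrow> policy set" where
  "ci_policies \<xi> b C budget =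
     {\<pi>. is_policy \<pi> \<and>
        (\<forall>\<nu>\<in>family \<xi> b. \<forall>\<delta>\<in>{0<..<1}.
           measure (joint_law \<nu> C)
             {\<omega> \<in> space (joint_law \<nu> C).
                ereal (mean_of \<nu>) \<in> {reported (fst \<pi>) budget \<delta> \<omega>..reported (snd \<pi>) budget \<delta> \<omega>}}
           \<ge> 1 - \<delta>)}"

text \<open>Convergence in probability as \<open>\<delta> \<down> 0\<close> to a deterministic extended real, phrased with
  neighbourhoods so as to cover infinite limits.\<close>

definition tendsto_in_prob :: "'a measure \<Rightarrow> (real \<Rightarrow> 'a \<Rightarrow> ereal) \<Rightarrow> ereal \<Rightarrow> bool" where
  "tendsto_in_prob P Y l \<longleftrightarrow>
     (\<forall>U. open U \<longrightarrow> l \<in> U \<longrightarrow>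
        ((\<lambda>\<delta>. measure P {\<omega> \<in> space P. Y \<delta> \<omega> \<notin> U}) \<longlongrightarrow> 0) (at_right 0))"

definition limiting_endpoints ::
    "policy \<Rightarrow> real measure \<Rightarrow> real measure \<Rightarrow> (real \<Rightarrow> real) \<Rightarrow> ereal \<Rightarrow> ereal \<Rightarrow> bool" where
  "limiting_endpoints \<pi> \<nu> C budget L R \<longleftrightarrow>
     L \<le> ereal (mean_of \<nu>) \<and> ereal (mean_of \<nu>) \<le> R \<and>
     tendsto_in_prob (joint_law \<nu> C) (reported (fst \<pi>) budget) L \<and>
     tendsto_in_prob (joint_law \<nu> C) (reported (snd \<pi>) budget) R"

definition stable_ci_policies ::
    "real measure \<Rightarrow> (real \<Rightarrow> real) \<Rightarrow> real measure \<Rightarrow> real measure \<Rightarrow> (real \<Rightarrow> real) \<Rightarrow> policy set" where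
  "stable_ci_policies \<xi> b \<nu> C budget =
     {\<pi> \<in> ci_policies \<xi> b C budget. \<exists>L R. limiting_endpoints \<pi> \<nu> C budget L R}"


section \<open>The threshold\<close>

definition psi :: "real \<Rightarrow> real" where
  "psi u = u - ln u"

definition psi_inv :: "real \<Rightarrow> real" where
  "psi_inv = the_inv_into {1..} psi"

definition psi_tilde :: "real \<Rightarrow> real \<Rightarrow> real" where
  "psi_tilde y x =
     (if x \<ge> psi_inv (1 / ln y) then exp (1 / psi_inv x) * psi_inv x else y * (x - ln (ln y)))"

definition zeta2 :: real where
  "zeta2 = (\<Sum>n. 1 / (real (Suc n))\<^sup>2)"

definition thr :: "real \<Rightarrow> real" where
  "thr x = 2 * psi_tilde (3/2) ((x + ln (2 * zeta2)) / 2)"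

definition beta_thr :: "nat \<Rightarrow> real \<Rightarrow> real" where
  "beta_thr n \<delta> = 3 * ln (1 + ln (real n)) + thr (ln (1 / \<delta>))"


section \<open>The policy based on the divergence\<close>

definition emp_mean :: "nat \<Rightarrow> (nat \<Rightarrow> real) \<Rightarrow> real" where
  "emp_mean n x = (\<Sum>i<n. x i) / real n"

definition kl_right :: "real measure \<Rightarrow> (real \<Rightarrow> real) \<Rightarrow> endpoint" where
  "kl_right \<xi> b n \<delta> x =
     (if n = 0 then Sup (ereal ` means \<xi> b)
      else let m = emp_mean n x;
               A = {q \<in> means \<xi> b. q > m \<and> ereal (real n) * dvg \<xi> b m q \<le> ereal (beta_thr n \<delta>)}
           in if A = {} then ereal m else Sup (ereal ` A))"

definition kl_left :: "real measure \<Rightarrow> (real \<Rightarrow> real) \<Rightarrow> endpoint" where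
  "kl_left \<xi> b n \<delta> x =
     (if n = 0 then Inf (ereal ` means \<xi> b)
      else let m = emp_mean n x;
               A = {q \<in> means \<xi> b. q < m \<and> ereal (real n) * dvg \<xi> b m q \<le> ereal (beta_thr n \<delta>)}
           in if A = {} then ereal m else Inf (ereal ` A))"

definition kl_policy :: "real measure \<Rightarrow> (real \<Rightarrow> real) \<Rightarrow> policy" where
  "kl_policy \<xi> b = (kl_left \<xi> b, kl_right \<xi> b)"


section \<open>The limiting endpoints\<close>

definition right_solution :: "real measure \<Rightarrow> (real \<Rightarrow> real) \<Rightarrow> real \<Rightarrow> real \<Rightarrow> real \<Rightarrow> real \<Rightarrow> bool" where
  "right_solution \<xi> b \<mu> k cbar q \<longleftrightarrow> q \<in> means \<xi> b \<and> q > \<mu> \<and> dvg \<xi> b \<mu> q = ereal (cbar / k)"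

definition left_solution :: "real measure \<Rightarrow> (real \<Rightarrow> real) \<Rightarrow> real \<Rightarrow> real \<Rightarrow> real \<Rightarrow> real \<Rightarrow> bool" where
  "left_solution \<xi> b \<mu> k cbar q \<longleftrightarrow> q \<in> means \<xi> b \<and> q < \<mu> \<and> dvg \<xi> b \<mu> q = ereal (cbar / k)"

definition mu_R_star :: "real measure \<Rightarrow> (real \<Rightarrow> real) \<Rightarrow> real \<Rightarrow> real \<Rightarrow> real \<Rightarrow> real" where
  "mu_R_star \<xi> b \<mu> k cbar = (THE q. right_solution \<xi> b \<mu> k cbar q)"

definition mu_L_star :: "real measure \<Rightarrow> (real \<Rightarrow> real) \<Rightarrow> real \<Rightarrow> real \<Rightarrow> real \<Rightarrow> real" where
  "mu_L_star \<xi> b \<mu> k cbar = (THE q. left_solution \<xi> b \<mu> k cbar q)"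

text \<open>The divergence \<open>dvg \<xi> b \<mu>\<close> may be bounded on one side of \<open>\<mu>\<close>: take
  \<open>\<xi>\<close> with density \<open>exp (- x) / x\<^sup>2\<close> on \<open>{1<..}\<close>, where the parameter set is \<open>{..<1}\<close> and
  \<open>b\<close> stays bounded near \<open>1\<close> while the mean tends to infinity. A solution therefore
  exists on a given side exactly when the level \<open>cbar / k\<close> is reached on that side.\<close>

definition level_reached_right :: "real measure \<Rightarrow> (real \<Rightarrow> real) \<Rightarrow> real \<Rightarrow> real \<Rightarrow> real \<Rightarrow> bool" where
  "level_reached_right \<xi> b \<mu> k cbar \<longleftrightarrow> (\<exists>q\<in>means \<xi> b. q > \<mu> \<and> dvg \<xi> b \<mu> q \<ge> ereal (cbar / k))"

definition level_reached_left :: "real measure \<Rightarrow> (real \<Rightarrow> real) \<Rightarrow> real \<Rightarrow> real \<Rightarrow> real \<Rightarrow> bool" where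
  "level_reached_left \<xi> b \<mu> k cbar \<longleftrightarrow> (\<exists>q\<in>means \<xi> b. q < \<mu> \<and> dvg \<xi> b \<mu> q \<ge> ereal (cbar / k))"

end

theory Submission
  imports Defs "HOL-Real_Asymp.Real_Asymp"
begin

text \<open>
  Coverage. The number of samples depends on the costs alone, so by Fubini's theorem it suffices to
  bound the probability of missing the mean \<open>\<mu>\<close> for each fixed number \<open>n\<close> of samples
  (\<open>independent_index\<close>). The interval misses \<open>\<mu>\<close> only if the divergence \<open>d\<close> from the empirical
  mean to \<open>\<mu>\<close> exceeds \<open>\<beta>(n, \<delta>) / n\<close>. As \<open>d(y, \<mu>)\<close> is the Legendre transform at \<open>y\<close> of the
  logarithmic moment generating function (\<open>dvg_eq_SUP\<close>), applying Chernoff's bound on both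
  sides bounds the miss probability by \<open>2 exp (- \<beta>(n, \<delta>))\<close>, and the threshold satisfies \<open>\<beta>(n, \<delta>) \<ge> ln (2 / \<delta>)\<close>.

  Limits. By the law of large numbers for the costs, the budget per sample \<open>C\<^sub>\<delta> / \<tau>\<close> converges in
  probability to the mean cost \<open>c\<close>; in particular \<open>\<tau>\<close> tends to infinity and, again by
  independence, the empirical mean at time \<open>\<tau>\<close> converges to \<open>\<mu>\<close>. The threshold is asymptotic to
  \<open>ln (1 / \<delta>)\<close>, so the level \<open>\<beta>(\<tau>, \<delta>) / \<tau>\<close> at which the policy cuts off the divergence
  converges in probability to \<open>c / K\<close>, where \<open>K\<close> is the limit of \<open>C\<^sub>\<delta> / ln (1 / \<delta>)\<close>
  (\<open>cutoff_tendsto\<close>). It remains to see that each endpoint, as a function of the empirical mean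
  and of the level, is continuous at \<open>(\<mu>, c / K)\<close>, also for the levels \<open>0\<close> and \<open>\<infinity>\<close>
  (\<open>tendsto_upper\<close>). This holds because \<open>d\<close> is continuous in its first argument and strictly
  increasing in its second one away from the first. At level \<open>0\<close> both endpoints equal \<open>\<mu>\<close>; at a
  positive level attained by the divergence they are the solutions of the equation for it.

  The facts about the family that enter are consequences of Jensen's inequality: it makes the mean
  a subgradient of \<open>b\<close>, hence its derivative, and it yields the variational formula for \<open>d\<close>.
\<close>

section \<open>The threshold function\<close>

lemma
  assumes "1 \<le> z"
  shows psi_inv_ge_1: "1 \<le> psi_inv z" and psi_psi_inv: "psi (psi_inv z) = z"
    and psi_inv_ge: "z \<le> psi_inv z"
proof -
  have mono: "psi u < psi v" if "1 \<le> u" "u < v" for u v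
  proof -
    have "ln (v / u) < v / u - 1"
      using that ln_le_minus_one[of "v/u"] ln_eq_minus_one[of "v/u"] by force
    also have "\<dots> = (v - u) / u" using that by (simp add: field_simps)
    also have "\<dots> \<le> v - u" using that by (simp add: divide_le_eq mult_le_cancel_left1)
    finally show ?thesis using that by (simp add: psi_def ln_div)
  qed
  have inj: "inj_on psi {1..}"
    by (rule linorder_inj_onI) (use mono in \<open>force+\<close>)
  \<comment> \<open>The point \<^term>\<open>2 * z\<close> is an upper end for the intermediate value theorem.\<close>
  have "ln (2 * z) \<le> z"
    using ln_le_minus_one[of z] ln_le_minus_one[of 2] assms by (simp add: ln_mult)
  then have "z \<le> psi (2 * z)"
    by (simp add: psi_def)
  moreover have "continuous_on {1..2 * z} psi"
    unfolding psi_def by (intro continuous_intros) auto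
  ultimately obtain u where "1 \<le> u" "psi u = z"
    using IVT'[of psi 1 z "2 * z"] assms by (auto simp: psi_def)
  then have "z \<in> psi ` {1..}" by auto
  then show *: "1 \<le> psi_inv z" "psi (psi_inv z) = z"
    using the_inv_into_into[OF inj] f_the_inv_into_f[OF inj] by (auto simp: psi_inv_def)
  have "0 \<le> ln (psi_inv z)" using *(1) by (rule ln_ge_zero)
  then show "z \<le> psi_inv z"
    using *(2) unfolding psi_def by linarith
qed

lemma ln_three_halves: "0 < ln (3/2 :: real)" "ln (3/2 :: real) \<le> 1"
  using ln_le_minus_one[of "3/2"] by auto

lemma psi_tilde_ge:
  assumes "0 \<le> x"
  shows "x \<le> psi_tilde (3/2) x"
proof (cases "x \<ge> psi_inv (1 / ln (3/2))")
  case True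
  have "1 \<le> psi_inv (1 / ln (3/2))"
    by (rule psi_inv_ge_1) (use ln_three_halves in \<open>simp add: le_divide_eq\<close>)
  with True have "1 \<le> x" by linarith
  then have "0 \<le> psi_inv x"
    using psi_inv_ge_1[of x] by auto
  have "x \<le> 1 * psi_inv x"
    using psi_inv_ge[OF \<open>1 \<le> x\<close>] by simp
  also have "1 * psi_inv x \<le> exp (1 / psi_inv x) * psi_inv x"
    by (intro mult_right_mono) (use \<open>0 \<le> psi_inv x\<close> in auto)
  finally show ?thesis using True by (simp add: psi_tilde_def)
next
  case False
  have "ln (ln (3/2 :: real)) \<le> 0"
    using ln_three_halves by (subst ln_le_zero_iff) auto
  with assms have "x \<le> 3/2 * (x - ln (ln (3/2)))"
    by argo
  then show ?thesis
    using False by (simp add: psi_tilde_def)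
qed

lemma zeta2_ge_1: "1 \<le> zeta2"
proof -
  have "summable (\<lambda>n. 1 / (real (Suc n))\<^sup>2)"
    using inverse_squares_sums by (auto simp: sums_iff)
  from sum_le_suminf[OF this, of "{0}"] show ?thesis
    by (simp add: zeta2_def)
qed

text \<open>The summand \<^term>\<open>ln 2\<close> pays for the union of the two tails in Chernoff's bound. It comes
  from the shift by \<^term>\<open>ln (2 * zeta2)\<close> in the definition of the threshold.\<close>

lemma thr_ge:
  assumes "0 \<le> x"
  shows "x + ln 2 \<le> thr x"
proof -
  have "ln 2 \<le> ln (2 * zeta2)" "0 \<le> ln (2 * zeta2)"
    using zeta2_ge_1 by auto
  then show ?thesis
    using psi_tilde_ge[of "(x + ln (2 * zeta2)) / 2"] assms by (simp add: thr_def)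
qed

lemma beta_thr_ge:
  assumes "0 < \<delta>" "\<delta> < 1" "0 < n"
  shows "ln (2 / \<delta>) \<le> beta_thr n \<delta>"
proof -
  have "0 \<le> ln (real n)" using assms(3) by (intro ln_ge_zero) auto
  then have "0 \<le> ln (1 + ln (real n))" by (intro ln_ge_zero) auto
  moreover have "ln (1 / \<delta>) + ln 2 \<le> thr (ln (1 / \<delta>))"
    using assms by (intro thr_ge) simp
  moreover have "ln (2 / \<delta>) = ln (1 / \<delta>) + ln 2"
    using assms by (simp add: ln_div)
  ultimately show ?thesis
    unfolding beta_thr_def by linarith
qed

text \<open>Since \<^term>\<open>psi u\<close> differs from \<^term>\<open>u\<close> by a logarithm, its inverse is
  asymptotically the identity, and the factor \<^term>\<open>exp (1 / psi_inv x)\<close> tends to one.\<close>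

lemma thr_asymp: "((\<lambda>x. thr x / x) \<longlongrightarrow> 1) at_top"
proof -
  have top: "filterlim psi_inv at_top at_top"
    by (rule filterlim_at_top_mono[OF filterlim_ident])
       (use psi_inv_ge in \<open>auto intro!: eventually_at_top_linorderI[of 1]\<close>)
  have "((\<lambda>u::real. psi u / u) \<longlongrightarrow> 1) at_top"
    unfolding psi_def by real_asymp
  then have "((\<lambda>z. psi (psi_inv z) / psi_inv z) \<longlongrightarrow> 1) at_top"
    using top by (rule filterlim_compose)
  then have "((\<lambda>z. inverse (psi (psi_inv z) / psi_inv z)) \<longlongrightarrow> inverse 1) at_top"
    by (intro tendsto_inverse) auto
  then have 1: "((\<lambda>z. inverse (psi (psi_inv z) / psi_inv z)) \<longlongrightarrow> 1) at_top"
    by simp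
  have "((\<lambda>u::real. exp (1 / u)) \<longlongrightarrow> 1) at_top"
    by real_asymp
  then have 2: "((\<lambda>z. exp (1 / psi_inv z)) \<longlongrightarrow> 1) at_top"
    using top by (rule filterlim_compose)
  have "((\<lambda>z. psi_tilde (3/2) z / z) \<longlongrightarrow> 1) at_top"
  proof (rule Lim_transform_eventually)
    show "((\<lambda>z. exp (1 / psi_inv z) * inverse (psi (psi_inv z) / psi_inv z)) \<longlongrightarrow> 1) at_top"
      using tendsto_mult[OF 2 1] by simp
    show "\<forall>\<^sub>F z in at_top. exp (1 / psi_inv z) * inverse (psi (psi_inv z) / psi_inv z)
            = psi_tilde (3/2) z / z"
      using eventually_ge_at_top[of "psi_inv (1 / ln (3/2))"] eventually_ge_at_top[of 1]
      by eventually_elim (simp add: psi_tilde_def psi_psi_inv)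
  qed
  moreover define c where "c = ln (2 * zeta2)"
  have "filterlim (\<lambda>x. (x + c) / 2) at_top at_top"
    by real_asymp
  ultimately have 3: "((\<lambda>x. psi_tilde (3/2) ((x + c) / 2) / ((x + c) / 2)) \<longlongrightarrow> 1) at_top"
    by (rule filterlim_compose)
  have 4: "((\<lambda>x. (x + c) / x) \<longlongrightarrow> 1) at_top"
    by real_asymp
  show ?thesis
  proof (rule Lim_transform_eventually)
    show "((\<lambda>x. psi_tilde (3/2) ((x + c) / 2) / ((x + c) / 2) * ((x + c) / x)) \<longlongrightarrow> 1) at_top"
      using tendsto_mult[OF 3 4] by simp
    show "\<forall>\<^sub>F x in at_top. psi_tilde (3/2) ((x + c) / 2) / ((x + c) / 2) * ((x + c) / x) = thr x / x"
      using eventually_gt_at_top[of "\<bar>c\<bar>"]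
      by eventually_elim (auto simp: thr_def c_def)
  qed
qed

section \<open>Averages of independent copies of a real random variable\<close>

locale iid_reals = prob_space N for N :: "real measure" +
  assumes sets_N: "sets N = sets borel"
begin

abbreviation law :: "(nat \<Rightarrow> real) measure" where
  "law \<equiv> \<Pi>\<^sub>M i\<in>UNIV. N"

sublocale S: prob_space law
  by (intro prob_space_PiM) unfold_locales

lemma space_law: "space law = UNIV"
  using sets_eq_imp_space_eq[OF sets_N] by (simp add: space_PiM)

lemma measurable_coordinate [measurable]: "(\<lambda>x. x i) \<in> borel_measurable law"
proof -
  have "(\<lambda>x. x i) \<in> measurable law N" by measurable
  then show ?thesis by (simp add: measurable_cong_sets[OF refl sets_N])
qed

lemma measurable_N [simp]: "measurable N M = measurable borel M"
  by (rule measurable_cong_sets[OF sets_N refl])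

lemma distr_coordinate: "distr law borel (\<lambda>x. x i) = N"
proof -
  have "distr law borel (\<lambda>x. x i) = distr law N (\<lambda>x. x i)"
    by (rule distr_cong) (simp_all add: sets_N)
  also have "\<dots> = N"
    by (rule distr_PiM_component) (auto intro: prob_space_axioms)
  finally show ?thesis .
qed

lemma integrable_coordinate:
  fixes f :: "real \<Rightarrow> real"
  assumes "f \<in> borel_measurable borel"
  shows "integrable law (\<lambda>x. f (x i)) \<longleftrightarrow> integrable N f"
  using integrable_distr_eq[of "\<lambda>x. x i" law borel f] assms by (simp add: distr_coordinate)

lemma integral_coordinate:
  fixes f :: "real \<Rightarrow> real"
  assumes "f \<in> borel_measurable borel"
  shows "(\<integral>x. f (x i) \<partial>law) = (\<integral>x. f x \<partial>N)"
  using integral_distr[of "\<lambda>x. x i" law borel f] assms by (simp add: distr_coordinate)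

lemma indep_coordinates:
  fixes f :: "real \<Rightarrow> real"
  assumes "f \<in> borel_measurable borel"
  shows "S.indep_vars (\<lambda>_. borel) (\<lambda>i x. f (x i)) I"
proof (cases "I = {}")
  case False
  have "S.indep_vars (\<lambda>_. borel) (\<lambda>i x. x i) I"
  proof (subst S.indep_vars_iff_distr_eq_PiM'[OF False])
    have "distr law (\<Pi>\<^sub>M i\<in>I. borel) (\<lambda>x. \<lambda>i\<in>I. x i) = distr law (\<Pi>\<^sub>M i\<in>I. N) (\<lambda>x. \<lambda>i\<in>I. x i)"
      by (intro distr_cong sets_PiM_cong) (simp_all add: sets_N)
    also have "\<dots> = (\<Pi>\<^sub>M i\<in>I. N)"
      by (rule distr_PiM_reindex[where f = "\<lambda>i. i" and M = "\<lambda>_. N"])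
         (auto intro: prob_space_axioms)
    finally show "distr law (\<Pi>\<^sub>M i\<in>I. borel) (\<lambda>x. \<lambda>i\<in>I. x i)
        = (\<Pi>\<^sub>M i\<in>I. distr law borel (\<lambda>x. x i))"
      by (simp add: distr_coordinate)
  qed auto
  then show ?thesis
    using S.indep_vars_compose2[of "\<lambda>_. borel" "\<lambda>i x. x i" I "\<lambda>_. f" "\<lambda>_. borel"] assms by simp
qed (simp add: S.indep_vars_def S.indep_sets_def)

lemma measurable_emp_mean [measurable]: "emp_mean n \<in> borel_measurable law"
  unfolding emp_mean_def by measurable

lemma weak_law_bounded:
  fixes f :: "real \<Rightarrow> real"
  assumes [measurable]: "f \<in> borel_measurable borel"
    and bounded: "\<And>x. \<bar>f x\<bar> \<le> B" and "0 < B" "0 < \<epsilon>"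
  shows "(\<lambda>n. S.prob {x \<in> space law. \<epsilon> \<le> \<bar>(\<Sum>i<n. f (x i)) / real n - (\<integral>x. f x \<partial>N)\<bar>}) \<longlonglongrightarrow> 0"
proof (rule tendsto_sandwich[where f = "\<lambda>_. 0"])
  define c where "c = 2 * \<epsilon>\<^sup>2 / (B - (- B))\<^sup>2"
  have "0 < c" using assms(3,4) by (simp add: c_def)
  show "\<forall>\<^sub>F n in sequentially.
      S.prob {x \<in> space law. \<epsilon> \<le> \<bar>(\<Sum>i<n. f (x i)) / real n - (\<integral>x. f x \<partial>N)\<bar>}
        \<le> 2 * exp (- (c * real n))"
    using eventually_gt_at_top[of 0]
  proof eventually_elim
    case (elim n)
    interpret H: Hoeffding_ineq_iid law "{..<n}" "\<lambda>i x. f (x i)" "\<lambda>x. f (x 0)" "- B" B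
      "\<integral>x. f (x 0) \<partial>law"
    proof unfold_locales
      fix i assume "i \<in> {..<n}"
      have "distr law borel (\<lambda>x. f (x i)) = distr (distr law borel (\<lambda>x. x i)) borel f" for i
        by (subst distr_distr) (auto simp: o_def)
      then show "distr law borel (\<lambda>x. f (x i)) = distr law borel (\<lambda>x. f (x 0))"
        by (simp add: distr_coordinate)
    next
      show "AE x in law. f (x 0) \<in> {- B..B}"
        using bounded by (auto simp: abs_le_iff minus_le_iff)
    qed (auto intro!: indep_coordinates)
    have "- B < B" "0 \<le> \<epsilon>" "{..<n} \<noteq> {}" using assms(3,4) elim by auto
    moreover have "- 2 * real (card {..<n}) * \<epsilon>\<^sup>2 / (B - (- B))\<^sup>2 = - (c * real n)"
      by (simp add: c_def)
    ultimately show ?case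
      using H.Hoeffding_ineq_abs_ge'[of \<epsilon>]
      unfolding integral_coordinate[OF assms(1)] card_lessThan by metis
  qed
  show "(\<lambda>n. 2 * exp (- (c * real n))) \<longlonglongrightarrow> 0"
    using \<open>0 < c\<close> by real_asymp
qed auto

text \<open>The costs need not have a second moment, so the variable is clipped at a high level:
  the clipped averages concentrate by Hoeffding's inequality, and the remainder has a small first
  moment, which Markov's inequality turns into a small probability.\<close>

lemma weak_law:
  assumes int: "integrable N (\<lambda>x. x)" and "0 < \<epsilon>"
  shows "(\<lambda>n. S.prob {x \<in> space law. \<epsilon> \<le> \<bar>emp_mean n x - mean_of N\<bar>}) \<longlonglongrightarrow> 0"
proof (rule tendstoI)
  fix \<eta> :: real assume "0 < \<eta>"
  define clip where "clip B x = max (- B) (min B x)" for B x :: real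
  have [measurable]: "clip B \<in> borel_measurable borel" for B
    unfolding clip_def by measurable
  have "(\<lambda>k. \<integral>x. \<bar>x - clip (real k) x\<bar> \<partial>N) \<longlonglongrightarrow> (\<integral>x. 0 \<partial>N)"
  proof (rule integral_dominated_convergence)
    show "integrable N (\<lambda>x. \<bar>x\<bar>)" using int by simp
    show "AE x in N. (\<lambda>k. \<bar>x - clip (real k) x\<bar>) \<longlonglongrightarrow> 0"
    proof (rule AE_I2)
      fix x :: real
      obtain k0 :: nat where "\<bar>x\<bar> \<le> real k0" using real_arch_simple by blast
      then have "\<forall>\<^sub>F k in sequentially. \<bar>x - clip (real k) x\<bar> = 0"
        by (intro eventually_sequentiallyI[of k0]) (auto simp: clip_def)
      then show "(\<lambda>k. \<bar>x - clip (real k) x\<bar>) \<longlonglongrightarrow> 0"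
        by (rule tendsto_eventually)
    qed
  qed (auto simp: clip_def intro!: AE_I2)
  then have "\<forall>\<^sub>F k in sequentially. (\<integral>x. \<bar>x - clip (real k) x\<bar> \<partial>N) < min (\<epsilon> / 3) (\<eta> * \<epsilon> / 6)"
    using \<open>0 < \<epsilon>\<close> \<open>0 < \<eta>\<close> by (intro order_tendstoD) auto
  then have "\<forall>\<^sub>F k in sequentially. 0 < k \<and> (\<integral>x. \<bar>x - clip (real k) x\<bar> \<partial>N) < min (\<epsilon> / 3) (\<eta> * \<epsilon> / 6)"
    using eventually_gt_at_top[of 0] by eventually_elim auto
  then obtain k :: nat where k: "0 < k"
    and small: "(\<integral>x. \<bar>x - clip (real k) x\<bar> \<partial>N) < min (\<epsilon> / 3) (\<eta> * \<epsilon> / 6)"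
    by (auto dest: eventually_happens)
  define f where "f = clip (real k)"
  define g where "g x = \<bar>x - f x\<bar>" for x
  have [measurable]: "f \<in> borel_measurable borel" "g \<in> borel_measurable borel"
    unfolding f_def g_def[abs_def] by measurable
  have int_f: "integrable N f"
    by (rule integrable_const_bound[of _ "real k"]) (auto simp: f_def clip_def)
  have int_g: "integrable N g"
    unfolding g_def[abs_def] using int int_f by simp
  have mean: "\<bar>mean_of N - (\<integral>x. f x \<partial>N)\<bar> \<le> (\<integral>x. g x \<partial>N)"
    using integral_abs_bound[of N "\<lambda>x. x - f x"] int int_f by (simp add: mean_of_def g_def[abs_def])
  have g_tail: "S.prob {x \<in> space law. \<epsilon> / 3 \<le> (\<Sum>i<n. g (x i)) / real n} < \<eta> / 2" if "0 < n" for n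
  proof -
    have "integrable law (\<lambda>x. g (x i))" for i
      using int_g by (simp add: integrable_coordinate)
    then have "integrable law (\<lambda>x. (\<Sum>i<n. g (x i)) / real n)"
      by simp
    then have "S.prob {x \<in> space law. \<epsilon> / 3 \<le> (\<Sum>i<n. g (x i)) / real n}
        \<le> (\<integral>x. (\<Sum>i<n. g (x i)) / real n \<partial>law) / (\<epsilon> / 3)"
      using \<open>0 < \<epsilon>\<close>
      by (intro integral_Markov_inequality_measure[where A = "{}"] AE_I2)
         (auto simp: g_def intro!: sum_nonneg divide_nonneg_nonneg)
    also have "(\<integral>x. (\<Sum>i<n. g (x i)) / real n \<partial>law) = (\<integral>x. g x \<partial>N)"
      using int_g that by (simp add: integral_coordinate integrable_coordinate Bochner_Integration.integral_sum)
    also have "(\<integral>x. g x \<partial>N) / (\<epsilon> / 3) < \<eta> / 2"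
      using small \<open>0 < \<epsilon>\<close> by (simp add: g_def[abs_def] f_def field_simps)
    finally show ?thesis .
  qed
  have "(\<lambda>n. S.prob {x \<in> space law. \<epsilon> / 3 \<le> \<bar>(\<Sum>i<n. f (x i)) / real n - (\<integral>x. f x \<partial>N)\<bar>}) \<longlonglongrightarrow> 0"
    by (rule weak_law_bounded[of _ "real k"]) (use k \<open>0 < \<epsilon>\<close> in \<open>auto simp: f_def clip_def\<close>)
  then have "\<forall>\<^sub>F n in sequentially.
      S.prob {x \<in> space law. \<epsilon> / 3 \<le> \<bar>(\<Sum>i<n. f (x i)) / real n - (\<integral>x. f x \<partial>N)\<bar>} < \<eta> / 2"
    using \<open>0 < \<eta>\<close> by (intro order_tendstoD) auto
  then show "\<forall>\<^sub>F n in sequentially.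
      dist (S.prob {x \<in> space law. \<epsilon> \<le> \<bar>emp_mean n x - mean_of N\<bar>}) 0 < \<eta>"
    using eventually_gt_at_top[of 0]
  proof eventually_elim
    case (elim n)
    let ?A = "{x \<in> space law. \<epsilon> / 3 \<le> \<bar>(\<Sum>i<n. f (x i)) / real n - (\<integral>x. f x \<partial>N)\<bar>}"
    let ?B = "{x \<in> space law. \<epsilon> / 3 \<le> (\<Sum>i<n. g (x i)) / real n}"
    have "x \<in> ?A" if x: "x \<in> space law" "\<epsilon> \<le> \<bar>emp_mean n x - mean_of N\<bar>" "x \<notin> ?B" for x
    proof -
      have "\<bar>emp_mean n x - (\<Sum>i<n. f (x i)) / real n\<bar> = \<bar>\<Sum>i<n. x i - f (x i)\<bar> / real n"
        by (simp add: emp_mean_def sum_subtractf diff_divide_distrib[symmetric])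
      also have "\<dots> \<le> (\<Sum>i<n. g (x i)) / real n"
        unfolding g_def by (intro divide_right_mono sum_abs) auto
      also have "\<dots> < \<epsilon> / 3"
        using x by simp
      finally have "\<bar>emp_mean n x - (\<Sum>i<n. f (x i)) / real n\<bar> < \<epsilon> / 3" .
      moreover have "\<bar>mean_of N - (\<integral>x. f x \<partial>N)\<bar> < \<epsilon> / 3"
        using mean small by (simp add: g_def[abs_def] f_def)
      ultimately have "\<epsilon> / 3 \<le> \<bar>(\<Sum>i<n. f (x i)) / real n - (\<integral>x. f x \<partial>N)\<bar>"
        using x(2) by linarith
      then show "x \<in> ?A" using x(1) by simp
    qed
    then have "{x \<in> space law. \<epsilon> \<le> \<bar>emp_mean n x - mean_of N\<bar>} \<subseteq> ?A \<union> ?B"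
      by blast
    then have "S.prob {x \<in> space law. \<epsilon> \<le> \<bar>emp_mean n x - mean_of N\<bar>} \<le> S.prob (?A \<union> ?B)"
      by (intro S.finite_measure_mono) auto
    also have "\<dots> \<le> S.prob ?A + S.prob ?B"
      by (intro measure_Un_le) auto
    also have "\<dots> < \<eta>"
      using elim g_tail[of n] by linarith
    finally show ?case by simp
  qed
qed

text \<open>Markov's inequality for the product of the variables \<^term>\<open>exp (l * x i)\<close>. Positive tilts
  \<^term>\<open>l\<close> control the upper tail and negative ones the lower tail.\<close>

lemma chernoff:
  assumes "integrable N (\<lambda>x. exp (l * x))" "0 < n"
  shows "S.prob {x \<in> space law. t \<le> l * emp_mean n x - ln (\<integral>x. exp (l * x) \<partial>N)} \<le> exp (- (real n * t))"
proof -
  define Z where "Z = (\<integral>x. exp (l * x) \<partial>N)"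
  have "Z > 0"
  proof -
    have "Z \<noteq> 0"
      unfolding Z_def using assms(1)
      by (subst integral_nonneg_eq_0_iff_AE) auto
    then show ?thesis
      unfolding Z_def using Bochner_Integration.integral_nonneg[of N "\<lambda>x. exp (l * x)"]
      by (simp add: less_le)
  qed
  have int: "integrable law (\<lambda>x. exp (l * x i))" for i
    using assms(1) by (subst integrable_coordinate) auto
  have indep: "S.indep_vars (\<lambda>_. borel) (\<lambda>i x. exp (l * x i)) {..<n}"
    by (rule indep_coordinates[of "\<lambda>x. exp (l * x)"]) simp
  have "{x \<in> space law. t \<le> l * emp_mean n x - ln Z}
      = {x \<in> space law. exp (real n * t) * Z ^ n \<le> (\<Prod>i<n. exp (l * x i))}"
  proof (intro Collect_cong conj_cong refl)
    fix x
    have "t \<le> l * emp_mean n x - ln Z \<longleftrightarrow> real n * t + real n * ln Z \<le> (\<Sum>i<n. l * x i)"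
      using assms(2) by (simp add: emp_mean_def field_simps sum_distrib_left)
    also have "\<dots> \<longleftrightarrow> exp (real n * t + real n * ln Z) \<le> exp (\<Sum>i<n. l * x i)"
      by simp
    also have "exp (real n * t + real n * ln Z) = exp (real n * t) * Z ^ n"
      using \<open>Z > 0\<close> by (simp add: exp_add exp_of_nat_mult)
    also have "exp (\<Sum>i<n. l * x i) = (\<Prod>i<n. exp (l * x i))"
      by (simp add: exp_sum)
    finally show "t \<le> l * emp_mean n x - ln Z \<longleftrightarrow> exp (real n * t) * Z ^ n \<le> (\<Prod>i<n. exp (l * x i))" .
  qed
  also have "S.prob \<dots> \<le> (\<integral>x. (\<Prod>i<n. exp (l * x i)) \<partial>law) / (exp (real n * t) * Z ^ n)"
    using \<open>Z > 0\<close> S.indep_vars_integrable[OF _ indep int]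
    by (intro integral_Markov_inequality_measure[where A = "{}"] AE_I2)
       (auto intro!: prod_nonneg)
  also have "(\<integral>x. (\<Prod>i<n. exp (l * x i)) \<partial>law) = Z ^ n"
    using S.indep_vars_lebesgue_integral[OF _ indep int]
    by (simp add: integral_coordinate[of "\<lambda>x. exp (l * x)"] Z_def)
  also have "Z ^ n / (exp (real n * t) * Z ^ n) = exp (- (real n * t))"
    using \<open>Z > 0\<close> by (simp add: exp_minus field_simps)
  finally show ?thesis
    by (simp add: Z_def)
qed

end

text \<open>The threshold events form a chain, so a bound for each of them passes to their union even
  if there are uncountably many.\<close>

lemma (in finite_measure) measure_exceeds_some_le:
  fixes Y :: "'a \<Rightarrow> real"
  assumes [measurable]: "Y \<in> borel_measurable M" and "0 \<le> c"
    and le: "\<And>a. a \<in> S \<Longrightarrow> measure M {x \<in> space M. a < Y x} \<le> c"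
  shows "{x \<in> space M. \<exists>a\<in>S. a < Y x} \<in> sets M" "measure M {x \<in> space M. \<exists>a\<in>S. a < Y x} \<le> c"
proof -
  have "{x \<in> space M. \<exists>a\<in>S. a < Y x} \<in> sets M \<and> measure M {x \<in> space M. \<exists>a\<in>S. a < Y x} \<le> c"
  proof (cases "S = {}")
    case False
    then obtain f :: "nat \<Rightarrow> ereal" where f: "decseq f" "range f \<subseteq> ereal ` S" "Inf (ereal ` S) = (INF i. f i)"
      using Inf_countable_INF[of "ereal ` S"] by auto
    then have "\<forall>i. \<exists>a\<in>S. f i = ereal a"
      by (auto simp: image_subset_iff)
    then obtain g where g: "\<And>i. g i \<in> S" "\<And>i. f i = ereal (g i)"
      by metis
    have "(\<exists>a\<in>S. a < y) \<longleftrightarrow> (\<exists>i. g i < y)" for y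
    proof -
      have "(\<exists>a\<in>S. a < y) \<longleftrightarrow> Inf (ereal ` S) < ereal y"
        by (simp add: Inf_less_iff)
      also have "\<dots> \<longleftrightarrow> (\<exists>i. g i < y)"
        by (simp add: f(3) INF_less_iff g(2))
      finally show ?thesis .
    qed
    then have eq: "{x \<in> space M. \<exists>a\<in>S. a < Y x} = (\<Union>i. {x \<in> space M. g i < Y x})"
      by auto
    have "g j \<le> g i" if "i \<le> j" for i j
      using decseqD[OF f(1) that] by (simp add: g(2))
    then have "incseq (\<lambda>i. {x \<in> space M. g i < Y x})"
      by (force simp: incseq_def)
    then have "(\<lambda>i. measure M {x \<in> space M. g i < Y x}) \<longlonglongrightarrow> measure M (\<Union>i. {x \<in> space M. g i < Y x})"
      by (intro finite_Lim_measure_incseq) auto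
    then have "measure M (\<Union>i. {x \<in> space M. g i < Y x}) \<le> c"
      by (rule LIMSEQ_le_const2) (use le g(1) in auto)
    then show ?thesis
      unfolding eq by simp
  qed (use assms(2) in simp)
  then show "{x \<in> space M. \<exists>a\<in>S. a < Y x} \<in> sets M" "measure M {x \<in> space M. \<exists>a\<in>S. a < Y x} \<le> c"
    by auto
qed

text \<open>For tilts of one sign the events in Chernoff's bound are half-lines of one direction for the
  empirical mean, so the bound survives taking the best tilt for each outcome.\<close>

lemma (in iid_reals) chernoff_all_tilts:
  fixes s t :: real
  assumes s: "s = 1 \<or> s = - 1" and "0 < n"
  defines "H \<equiv> {x \<in> space law. \<exists>l. 0 < l * s \<and> integrable N (\<lambda>x. exp (l * x)) \<and>
      t < l * emp_mean n x - ln (\<integral>x. exp (l * x) \<partial>N)}"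
  shows "H \<in> sets law" "S.prob H \<le> exp (- (real n * t))"
proof -
  define \<Lambda> where "\<Lambda> l = ln (\<integral>x. exp (l * x) \<partial>N)" for l
  define A where "A = (\<lambda>l. (t + \<Lambda> l) / (l * s)) ` {l. 0 < l * s \<and> integrable N (\<lambda>x. exp (l * x))}"
  have iff: "(t + \<Lambda> l) / (l * s) < s * m \<longleftrightarrow> t < l * m - \<Lambda> l" if "0 < l * s" for l m
  proof -
    have "(t + \<Lambda> l) / (l * s) < s * m \<longleftrightarrow> t + \<Lambda> l < s * m * (l * s)"
      using that by (rule pos_divide_less_eq)
    also have "s * m * (l * s) = l * m"
      using s by auto
    finally show ?thesis by auto
  qed
  have H: "H = {x \<in> space law. \<exists>a\<in>A. a < s * emp_mean n x}"
    unfolding H_def A_def \<Lambda>_def[symmetric] using iff by auto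
  have bound: "S.prob {x \<in> space law. a < s * emp_mean n x} \<le> exp (- (real n * t))" if "a \<in> A" for a
  proof -
    obtain l where l: "0 < l * s" "integrable N (\<lambda>x. exp (l * x))" "a = (t + \<Lambda> l) / (l * s)"
      using \<open>a \<in> A\<close> by (auto simp: A_def)
    have "{x \<in> space law. a < s * emp_mean n x} \<subseteq> {x \<in> space law. t \<le> l * emp_mean n x - \<Lambda> l}"
      unfolding l(3) using iff[OF l(1)] by auto
    then have "S.prob {x \<in> space law. a < s * emp_mean n x} \<le> S.prob {x \<in> space law. t \<le> l * emp_mean n x - \<Lambda> l}"
      by (intro S.finite_measure_mono) auto
    also have "\<dots> \<le> exp (- (real n * t))"
      unfolding \<Lambda>_def using l(2) \<open>0 < n\<close> by (rule chernoff)
    finally show ?thesis .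
  qed
  have "(\<lambda>x. s * emp_mean n x) \<in> borel_measurable law" by measurable
  from S.measure_exceeds_some_le[OF this _ bound]
  show "H \<in> sets law" "S.prob H \<le> exp (- (real n * t))"
    unfolding H by auto
qed

section \<open>The random sample size\<close>

text \<open>Positive costs make the partial sums increase, so the sample sizes within the budget form an
  initial segment.\<close>

lemma sample_size_between:
  assumes pos: "\<And>i. 0 < c i" and "1 \<le> n" "(\<Sum>i<n. c i) \<le> B" "B < (\<Sum>i<n'. c i)"
  shows "n \<le> sample_size B c" "sample_size B c < n'"
proof -
  define A where "A = {n. 1 \<le> n \<and> (\<Sum>i<n. c i) \<le> B}"
  have "k < n'" if "k \<in> A" for k
  proof (rule ccontr)
    assume "\<not> k < n'"
    then have "(\<Sum>i<n'. c i) \<le> (\<Sum>i<k. c i)"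
      using pos by (intro sum_mono2) (auto intro: less_imp_le)
    then show False using that assms(4) by (auto simp: A_def)
  qed
  moreover have "n \<in> A" using assms by (auto simp: A_def)
  moreover from calculation have "finite A"
    by (auto intro: finite_subset[of _ "{..<n'}"])
  ultimately show "n \<le> sample_size B c" "sample_size B c < n'"
    unfolding sample_size_def A_def[symmetric] by auto
qed

context iid_reals
begin

lemma measurable_sample_size [measurable]: "sample_size B \<in> measurable law (count_space UNIV)"
proof -
  let ?R = "\<lambda>n c. 1 \<le> n \<and> (\<Sum>i<n. c i) \<le> B"
  have "sample_size B = (\<lambda>c. if (\<exists>m. \<forall>n. ?R n c \<longrightarrow> n \<le> m) \<and> (\<exists>n. ?R n c) then Max {n. ?R n c} else 0)"
    by (auto simp: sample_size_def Let_def fun_eq_iff finite_nat_set_iff_bounded_le)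
  also have "\<dots> \<in> measurable law (count_space UNIV)"
    by measurable
  finally show ?thesis .
qed

text \<open>The elementary renewal theorem, in probability: \<^term>\<open>n\<close> costs exceed the budget
  \<^term>\<open>B\<close> or not according as \<^term>\<open>n\<close> is above or below \<^term>\<open>B / mean_of N\<close>, up to the error
  in the law of large numbers.\<close>

lemma budget_per_sample:
  assumes pos: "AE c in N. 0 < c" and int: "integrable N (\<lambda>x. x)"
    and "0 < mean_of N" "0 < \<epsilon>"
  shows "((\<lambda>B. S.prob {c \<in> space law. \<epsilon> \<le> \<bar>B / real (sample_size B c) - mean_of N\<bar>}) \<longlongrightarrow> 0) at_top"
proof -
  define \<mu> where "\<mu> = mean_of N"
  define e where "e = min \<epsilon> (\<mu> / 2)"
  have e: "0 < e" "e \<le> \<epsilon>" "e < \<mu>"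
    using assms by (auto simp: e_def \<mu>_def)
  define A where "A n = {c \<in> space law. e / 2 \<le> \<bar>emp_mean n c - \<mu>\<bar>}" for n
  \<comment> \<open>Typically \<^term>\<open>n1 B\<close> costs exceed the budget while \<^term>\<open>n2 B\<close> costs do not, which traps
    the sample size; for large \<^term>\<open>B\<close>, rounding in \<^term>\<open>n2 B\<close> changes the average
    cost by at most half of \<^term>\<open>e\<close>.\<close>
  define n1 where "n1 B = nat \<lceil>B / (\<mu> - e)\<rceil>" for B
  define n2 where "n2 B = nat \<lfloor>B / (\<mu> + e)\<rfloor> + 1" for B
  have A: "(\<lambda>n. S.prob (A n)) \<longlonglongrightarrow> 0"
    unfolding A_def \<mu>_def by (rule weak_law) (use int e in auto)
  have n1: "filterlim n1 at_top at_top" and n2: "filterlim n2 at_top at_top"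
    unfolding n1_def n2_def using e by real_asymp+
  have AE_pos: "AE c in law. \<forall>i. 0 < c i"
    unfolding AE_all_countable
    by (auto intro!: AE_PiM_component[where P = "\<lambda>x. 0 < x"] prob_space_axioms pos)
  have bound: "S.prob {c \<in> space law. \<epsilon> \<le> \<bar>B / real (sample_size B c) - \<mu>\<bar>} \<le> S.prob (A (n1 B)) + S.prob (A (n2 B))"
    if "0 < B" and big: "2 * (\<mu> + e) / e \<le> real (n2 B)" for B
  proof -
    have "c \<in> A (n1 B) \<union> A (n2 B)"
      if c: "\<And>i. 0 < c i" "\<epsilon> \<le> \<bar>B / real (sample_size B c) - \<mu>\<bar>" for c
    proof (rule ccontr)
      assume notin: "c \<notin> A (n1 B) \<union> A (n2 B)"
      have "0 < n1 B" "0 < n2 B"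
        using \<open>0 < B\<close> e by (auto simp: n1_def n2_def)
      have up: "B / (\<mu> - e) \<le> real (n1 B)"
        unfolding n1_def by linarith
      have n1_over: "B < (\<Sum>i<n1 B. c i)"
      proof (rule ccontr)
        assume "\<not> B < (\<Sum>i<n1 B. c i)"
        then have "(\<Sum>i<n1 B. c i) \<le> real (n1 B) * (\<mu> - e)"
          using up e by (simp add: pos_divide_le_eq)
        then have "emp_mean (n1 B) c \<le> \<mu> - e"
          using \<open>0 < n1 B\<close> by (simp add: emp_mean_def pos_divide_le_eq mult.commute)
        then show False using notin e by (auto simp: A_def space_law)
      qed
      have low: "real (n2 B) \<le> B / (\<mu> + e) + 1"
        unfolding n2_def using \<open>0 < B\<close> e by simp
      have n2_under: "(\<Sum>i<n2 B. c i) \<le> B"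
      proof (rule ccontr)
        assume "\<not> (\<Sum>i<n2 B. c i) \<le> B"
        moreover have "(real (n2 B) - 1) * (\<mu> + e) \<le> B"
          using low e pos_le_divide_eq[of "\<mu> + e" "real (n2 B) - 1" B] by simp
        moreover have "\<mu> + e \<le> real (n2 B) * (e / 2)"
          using big e by (simp add: field_simps)
        ultimately have "real (n2 B) * (\<mu> + e / 2) \<le> (\<Sum>i<n2 B. c i)"
          by (simp add: algebra_simps)
        then have "\<mu> + e / 2 \<le> emp_mean (n2 B) c"
          using \<open>0 < n2 B\<close> by (simp add: emp_mean_def pos_le_divide_eq mult.commute)
        then show False using notin e by (auto simp: A_def space_law)
      qed
      have *: "n2 B \<le> sample_size B c" "sample_size B c < n1 B"
        using sample_size_between[of c "n2 B" B "n1 B"] c(1) n1_over n2_under \<open>0 < n2 B\<close> by auto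
      have "B / (\<mu> + e) < real (n2 B)"
        unfolding n2_def by linarith
      with *(1) have 1: "B / (\<mu> + e) < real (sample_size B c)" by simp
      have 2: "real (sample_size B c) < B / (\<mu> - e)"
        using *(2) unfolding n1_def by linarith
      have "0 < real (sample_size B c)" using *(1) \<open>0 < n2 B\<close> by simp
      then have "B / real (sample_size B c) < \<mu> + e" "\<mu> - e < B / real (sample_size B c)"
        using 1 2 e by (simp_all add: field_simps)
      then show False using c(2) e by linarith
    qed
    then have "AE c in law. c \<in> {c \<in> space law. \<epsilon> \<le> \<bar>B / real (sample_size B c) - \<mu>\<bar>}
        \<longrightarrow> c \<in> A (n1 B) \<union> A (n2 B)"
      using AE_pos by (auto elim: eventually_mono)
    then have "S.prob {c \<in> space law. \<epsilon> \<le> \<bar>B / real (sample_size B c) - \<mu>\<bar>} \<le> S.prob (A (n1 B) \<union> A (n2 B))"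
      by (rule S.finite_measure_mono_AE) (simp add: A_def)
    also have "\<dots> \<le> S.prob (A (n1 B)) + S.prob (A (n2 B))"
      by (intro measure_Un_le) (simp_all add: A_def)
    finally show ?thesis .
  qed
  have lim: "((\<lambda>B. S.prob (A (n1 B)) + S.prob (A (n2 B))) \<longlongrightarrow> 0) at_top"
    using tendsto_add[OF filterlim_compose[OF A n1] filterlim_compose[OF A n2]] by simp
  have "\<forall>\<^sub>F B in at_top. 2 * (\<mu> + e) / e \<le> real (n2 B)"
    using filterlim_compose[OF filterlim_real_sequentially n2] by (simp add: filterlim_at_top)
  then have ev: "\<forall>\<^sub>F B in at_top. S.prob {c \<in> space law. \<epsilon> \<le> \<bar>B / real (sample_size B c) - \<mu>\<bar>}
      \<le> S.prob (A (n1 B)) + S.prob (A (n2 B))"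
    using eventually_gt_at_top[of 0] by eventually_elim (rule bound)
  show ?thesis
    unfolding \<mu>_def[symmetric] by (rule tendsto_sandwich[OF _ ev tendsto_const lim]) simp
qed

end

section \<open>Samples together with costs\<close>

text \<open>Fubini's theorem lets an index that depends on an independent coordinate be treated as fixed.
  This is the reason why bounds at each single sample size suffice.\<close>

lemma independent_index:
  assumes X: "prob_space X" and Y: "prob_space Y"
    and [measurable]: "T \<in> measurable Y (count_space UNIV)" "\<And>n::nat. E n \<in> sets X"
    and le: "\<And>n. measure X (E n) \<le> \<eta>"
  defines "A \<equiv> {\<omega> \<in> space (X \<Otimes>\<^sub>M Y). fst \<omega> \<in> E (T (snd \<omega>))}"
  shows "A \<in> sets (X \<Otimes>\<^sub>M Y)" "measure (X \<Otimes>\<^sub>M Y) A \<le> \<eta>"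
proof -
  interpret X: prob_space X by fact
  interpret Y: prob_space Y by fact
  interpret pair_prob_space X Y ..
  have "0 \<le> \<eta>" using le[of 0] measure_nonneg[of X "E 0"] by linarith
  have "A = {\<omega> \<in> space (X \<Otimes>\<^sub>M Y). \<exists>n. T (snd \<omega>) = n \<and> fst \<omega> \<in> E n}"
    by (auto simp: A_def)
  also have "\<dots> \<in> sets (X \<Otimes>\<^sub>M Y)"
    by measurable
  finally show A: "A \<in> sets (X \<Otimes>\<^sub>M Y)" .
  have "emeasure (X \<Otimes>\<^sub>M Y) A = (\<integral>\<^sup>+y. emeasure X ((\<lambda>x. (x, y)) -` A) \<partial>Y)"
    using A by (rule emeasure_pair_measure_alt2)
  also have "\<dots> \<le> (\<integral>\<^sup>+y. ennreal \<eta> \<partial>Y)"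
  proof (rule nn_integral_mono)
    fix y assume "y \<in> space Y"
    then have "(\<lambda>x. (x, y)) -` A = E (T y)"
      using sets.sets_into_space[of "E (T y)" X] by (auto simp: A_def space_pair_measure)
    then show "emeasure X ((\<lambda>x. (x, y)) -` A) \<le> ennreal \<eta>"
      using le by (simp add: X.emeasure_eq_measure ennreal_leI)
  qed
  also have "\<dots> = ennreal \<eta>"
    by (simp add: Y.emeasure_space_1)
  finally show "measure (X \<Otimes>\<^sub>M Y) A \<le> \<eta>"
    using \<open>0 \<le> \<eta>\<close> by (simp add: emeasure_eq_measure)
qed

locale samples_and_costs = X: iid_reals \<nu> + Y: iid_reals C for \<nu> C :: "real measure" +
  fixes budget :: "real \<Rightarrow> real"
  assumes integrable_sample: "integrable \<nu> (\<lambda>x. x)"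
    and cost_pos: "AE c in C. 0 < c" and integrable_cost: "integrable C (\<lambda>x. x)"
    and mean_cost_pos: "0 < mean_of C"
    and budget_top: "filterlim budget at_top (at_right 0)"
begin

abbreviation "J \<equiv> joint_law \<nu> C"
abbreviation "\<tau> \<delta> \<omega> \<equiv> sample_size (budget \<delta>) (snd \<omega>)"

lemma J_eq: "J = X.law \<Otimes>\<^sub>M Y.law"
  by (simp add: joint_law_def)

sublocale pair_prob_space X.law Y.law ..

sublocale J: prob_space J
  unfolding J_eq by unfold_locales

lemma measurable_fst_J [measurable]: "fst \<in> measurable J X.law"
  and measurable_snd_J [measurable]: "snd \<in> measurable J Y.law"
  unfolding J_eq by measurable

lemma prob_cost_event:
  assumes "A \<in> sets Y.law"
  shows "J.prob {\<omega> \<in> space J. snd \<omega> \<in> A} = Y.S.prob A"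
proof -
  have "{\<omega> \<in> space J. snd \<omega> \<in> A} = space X.law \<times> A"
    using sets.sets_into_space[OF assms] by (auto simp: J_eq space_pair_measure)
  then show ?thesis
    using Y.S.emeasure_pair_measure_Times[OF sets.top assms, of X.law]
    by (simp add: J_eq measure_def X.S.emeasure_space_1)
qed

lemma budget_per_sample_tendsto:
  assumes "0 < \<epsilon>"
  shows "((\<lambda>\<delta>. J.prob {\<omega> \<in> space J. \<epsilon> \<le> \<bar>budget \<delta> / real (\<tau> \<delta> \<omega>) - mean_of C\<bar>}) \<longlongrightarrow> 0) (at_right 0)"
proof -
  have "J.prob {\<omega> \<in> space J. \<epsilon> \<le> \<bar>budget \<delta> / real (\<tau> \<delta> \<omega>) - mean_of C\<bar>}
      = Y.S.prob {c \<in> space Y.law. \<epsilon> \<le> \<bar>budget \<delta> / real (sample_size (budget \<delta>) c) - mean_of C\<bar>}" for \<delta>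
  proof -
    have "{c \<in> space Y.law. \<epsilon> \<le> \<bar>budget \<delta> / real (sample_size (budget \<delta>) c) - mean_of C\<bar>} \<in> sets Y.law"
      by measurable
    from prob_cost_event[OF this] show ?thesis
      by (simp add: Y.space_law)
  qed
  then show ?thesis
    using filterlim_compose[OF Y.budget_per_sample[OF cost_pos integrable_cost mean_cost_pos assms] budget_top]
    by simp
qed

text \<open>Where the budget per sample is close to the mean cost, the sample size exceeds any given
  \<^term>\<open>n0\<close> once the budget is large, and from there on the weak law bounds each deviation.\<close>

lemma stopped_mean_tendsto:
  assumes "0 < \<epsilon>"
  shows "((\<lambda>\<delta>. J.prob {\<omega> \<in> space J. \<epsilon> \<le> \<bar>emp_mean (\<tau> \<delta> \<omega>) (fst \<omega>) - mean_of \<nu>\<bar>}) \<longlongrightarrow> 0) (at_right 0)"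
proof (rule tendstoI)
  fix \<eta> :: real assume "0 < \<eta>"
  define m where "m = mean_of C"
  define E where "E n = {x \<in> space X.law. \<epsilon> \<le> \<bar>emp_mean n x - mean_of \<nu>\<bar>}" for n
  have [measurable]: "E n \<in> sets X.law" for n
    unfolding E_def by measurable
  have "\<forall>\<^sub>F n in sequentially. X.S.prob (E n) < \<eta> / 2"
    using X.weak_law[OF integrable_sample assms] \<open>0 < \<eta>\<close>
    unfolding E_def by (intro order_tendstoD) auto
  then obtain n0 where n0: "\<And>n. n0 \<le> n \<Longrightarrow> X.S.prob (E n) < \<eta> / 2"
    by (auto simp: eventually_sequentially)
  \<comment> \<open>The few indices that the weak law does not cover are discarded and accounted for by \<open>G\<close>.\<close>
  define E' where "E' n = (if n0 \<le> n then E n else {})" for n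
  have [measurable]: "E' n \<in> sets X.law" for n
    by (simp add: E'_def)
  define G where "G \<delta> = {\<omega> \<in> space J. m / 2 \<le> \<bar>budget \<delta> / real (\<tau> \<delta> \<omega>) - m\<bar>}" for \<delta>
  define H where "H \<delta> = {\<omega> \<in> space J. fst \<omega> \<in> E' (\<tau> \<delta> \<omega>)}" for \<delta>
  have H: "H \<delta> \<in> sets J" "J.prob (H \<delta>) \<le> \<eta> / 2" for \<delta>
    using independent_index[of X.law Y.law "sample_size (budget \<delta>)" E' "\<eta> / 2"]
      n0 \<open>0 < \<eta>\<close> X.S.prob_space_axioms Y.S.prob_space_axioms
    by (auto simp: H_def J_eq E'_def less_imp_le)
  have "\<forall>\<^sub>F \<delta> in at_right 0. J.prob (G \<delta>) < \<eta> / 2"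
    using budget_per_sample_tendsto[of "m / 2"] \<open>0 < \<eta>\<close> mean_cost_pos
    unfolding G_def m_def by (intro order_tendstoD) auto
  moreover have "\<forall>\<^sub>F \<delta> in at_right 0. 3 / 2 * m * real n0 < budget \<delta>"
    using budget_top unfolding filterlim_at_top_dense by blast
  ultimately show "\<forall>\<^sub>F \<delta> in at_right 0.
      dist (J.prob {\<omega> \<in> space J. \<epsilon> \<le> \<bar>emp_mean (\<tau> \<delta> \<omega>) (fst \<omega>) - mean_of \<nu>\<bar>}) 0 < \<eta>"
  proof eventually_elim
    case (elim \<delta>)
    have large: "n0 \<le> \<tau> \<delta> \<omega>" if "\<bar>budget \<delta> / real (\<tau> \<delta> \<omega>) - m\<bar> < m / 2" for \<omega>
    proof -
      have "\<tau> \<delta> \<omega> \<noteq> 0"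
        using that mean_cost_pos by (intro notI) (simp add: m_def)
      moreover have "budget \<delta> / real (\<tau> \<delta> \<omega>) < 3 / 2 * m"
        using that by linarith
      ultimately have "budget \<delta> < 3 / 2 * m * real (\<tau> \<delta> \<omega>)"
        by (simp add: pos_divide_less_eq)
      with elim(2) have "3 / 2 * m * real n0 < 3 / 2 * m * real (\<tau> \<delta> \<omega>)"
        by linarith
      then show ?thesis
        using mean_cost_pos by (simp add: m_def)
    qed
    have "\<omega> \<in> G \<delta> \<union> H \<delta>"
      if "\<omega> \<in> space J" "\<epsilon> \<le> \<bar>emp_mean (\<tau> \<delta> \<omega>) (fst \<omega>) - mean_of \<nu>\<bar>" for \<omega>
    proof (cases "\<bar>budget \<delta> / real (\<tau> \<delta> \<omega>) - m\<bar> < m / 2")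
      case True
      then show ?thesis
        using that large[OF True] by (simp add: H_def E'_def E_def X.space_law)
    next
      case False
      then show ?thesis
        using that by (simp add: G_def)
    qed
    then have "{\<omega> \<in> space J. \<epsilon> \<le> \<bar>emp_mean (\<tau> \<delta> \<omega>) (fst \<omega>) - mean_of \<nu>\<bar>} \<subseteq> G \<delta> \<union> H \<delta>"
      by blast
    then have "J.prob {\<omega> \<in> space J. \<epsilon> \<le> \<bar>emp_mean (\<tau> \<delta> \<omega>) (fst \<omega>) - mean_of \<nu>\<bar>} \<le> J.prob (G \<delta> \<union> H \<delta>)"
      using H by (intro J.finite_measure_mono) (auto simp: G_def)
    also have "\<dots> \<le> J.prob (G \<delta>) + J.prob (H \<delta>)"
      using H by (intro measure_Un_le) (auto simp: G_def)
    also have "\<dots> < \<eta>"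
      using elim(1) H(2)[of \<delta>] by linarith
    finally show ?case by simp
  qed
qed

text \<open>Convergence in probability is reduced to a deterministic statement on the event that both the
  empirical mean and the budget per sample are close to their limits.\<close>

lemma tendsto_in_probI:
  assumes "\<And>U. open U \<Longrightarrow> l \<in> U \<Longrightarrow> \<exists>\<epsilon>>0. \<forall>\<^sub>F \<delta> in at_right 0. \<forall>\<omega>.
      \<bar>emp_mean (\<tau> \<delta> \<omega>) (fst \<omega>) - mean_of \<nu>\<bar> < \<epsilon> \<longrightarrow> \<bar>budget \<delta> / real (\<tau> \<delta> \<omega>) - mean_of C\<bar> < \<epsilon> \<longrightarrow> Z \<delta> \<omega> \<in> U"
  shows "tendsto_in_prob J Z l"
  unfolding tendsto_in_prob_def
proof (intro allI impI)
  fix U assume "open U" "l \<in> U"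
  then obtain \<epsilon> where "0 < \<epsilon>" and ev: "\<forall>\<^sub>F \<delta> in at_right 0. \<forall>\<omega>.
      \<bar>emp_mean (\<tau> \<delta> \<omega>) (fst \<omega>) - mean_of \<nu>\<bar> < \<epsilon> \<longrightarrow> \<bar>budget \<delta> / real (\<tau> \<delta> \<omega>) - mean_of C\<bar> < \<epsilon> \<longrightarrow> Z \<delta> \<omega> \<in> U"
    using assms by blast
  let ?H = "\<lambda>\<delta>. {\<omega> \<in> space J. \<epsilon> \<le> \<bar>emp_mean (\<tau> \<delta> \<omega>) (fst \<omega>) - mean_of \<nu>\<bar>}"
  let ?G = "\<lambda>\<delta>. {\<omega> \<in> space J. \<epsilon> \<le> \<bar>budget \<delta> / real (\<tau> \<delta> \<omega>) - mean_of C\<bar>}"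
  have [measurable]: "?G \<delta> \<in> sets J" for \<delta>
    by measurable
  have [measurable]: "?H \<delta> \<in> sets J" for \<delta>
  proof -
    have "?H \<delta> = {\<omega> \<in> space J. \<exists>n. \<tau> \<delta> \<omega> = n \<and> \<epsilon> \<le> \<bar>emp_mean n (fst \<omega>) - mean_of \<nu>\<bar>}"
      by auto
    also have "\<dots> \<in> sets J" by measurable
    finally show ?thesis .
  qed
  have lim: "((\<lambda>\<delta>. J.prob (?H \<delta>) + J.prob (?G \<delta>)) \<longlongrightarrow> 0) (at_right 0)"
    using tendsto_add[OF stopped_mean_tendsto budget_per_sample_tendsto] \<open>0 < \<epsilon>\<close> by simp
  have bound: "\<forall>\<^sub>F \<delta> in at_right 0. J.prob {\<omega> \<in> space J. Z \<delta> \<omega> \<notin> U} \<le> J.prob (?H \<delta>) + J.prob (?G \<delta>)"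
    using ev
  proof eventually_elim
    case (elim \<delta>)
    then have "{\<omega> \<in> space J. Z \<delta> \<omega> \<notin> U} \<subseteq> ?H \<delta> \<union> ?G \<delta>"
      unfolding not_le[symmetric] by blast
    then have "J.prob {\<omega> \<in> space J. Z \<delta> \<omega> \<notin> U} \<le> J.prob (?H \<delta> \<union> ?G \<delta>)"
      by (intro J.finite_measure_mono) auto
    also have "\<dots> \<le> J.prob (?H \<delta>) + J.prob (?G \<delta>)"
      by (intro measure_Un_le) auto
    finally show ?case .
  qed
  show "((\<lambda>\<delta>. J.prob {\<omega> \<in> space J. Z \<delta> \<omega> \<notin> U}) \<longlongrightarrow> 0) (at_right 0)"
    by (rule tendsto_sandwich[OF _ bound tendsto_const lim]) simp
qed

end

section \<open>Confidence endpoints of a divergence\<close>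

text \<open>These properties of a divergence determine the behaviour of the right endpoint. The left
  endpoint is obtained from the same locale for the reflected divergence.\<close>

locale right_divergence =
  fixes Q :: "real set" and D :: "real \<Rightarrow> real \<Rightarrow> ereal"
  assumes open_Q: "open Q" and interval_Q: "is_interval Q"
    and antimono_fst: "\<lbrakk>q \<in> Q; y \<le> y'; y' \<le> q\<rbrakk> \<Longrightarrow> D y' q \<le> D y q"
    and strict_snd: "\<lbrakk>y \<in> Q; q \<in> Q; r \<in> Q; y \<le> q; q < r\<rbrakk> \<Longrightarrow> D y q < D y r"
    and cont_fst: "\<lbrakk>y \<in> Q; q \<in> Q\<rbrakk> \<Longrightarrow> ((\<lambda>y. D y q) \<longlongrightarrow> D y q) (nhds y)"
begin

text \<open>Including \<^term>\<open>m\<close> in the set accounts for the convention that the endpoint is the empirical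
  mean if no point is admitted.\<close>

definition upper :: "real \<Rightarrow> ereal \<Rightarrow> ereal" where
  "upper m t = Sup (ereal ` insert m {q \<in> Q. m < q \<and> D m q \<le> t})"

lemma le_upper: "ereal m \<le> upper m t"
  unfolding upper_def by (intro Sup_upper) auto

lemma upper_member: "\<lbrakk>q \<in> Q; m < q; D m q \<le> t\<rbrakk> \<Longrightarrow> ereal q \<le> upper m t"
  unfolding upper_def by (intro Sup_upper) auto

lemma upper_least: "\<lbrakk>ereal m \<le> u; \<And>q. q \<in> Q \<Longrightarrow> m < q \<Longrightarrow> D m q \<le> t \<Longrightarrow> ereal q \<le> u\<rbrakk> \<Longrightarrow> upper m t \<le> u"
  unfolding upper_def by (intro Sup_least) auto

text \<open>A point stays admitted while \<^term>\<open>m\<close> moves towards it, and once \<^term>\<open>m\<close> has passed it, it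
  lies below the endpoint anyway. Monotonicity gives measurability of the endpoint.\<close>

lemma upper_mono:
  assumes "m \<le> m'"
  shows "upper m t \<le> upper m' t"
proof (rule upper_least)
  have "ereal m \<le> ereal m'" using assms by simp
  then show "ereal m \<le> upper m' t"
    using le_upper by (rule order_trans)
  fix q assume q: "q \<in> Q" "m < q" "D m q \<le> t"
  show "ereal q \<le> upper m' t"
  proof (cases "q \<le> m'")
    case True
    then have "ereal q \<le> ereal m'" by simp
    then show ?thesis using le_upper by (rule order_trans)
  next
    case False
    then have "D m' q \<le> D m q"
      using q assms by (intro antimono_fst) auto
    then show ?thesis
      using q False by (intro upper_member) auto
  qed
qed

lemma borel_measurable_upper: "(\<lambda>m. upper m t) \<in> borel_measurable borel"
proof (rule borel_measurableI_greater)
  fix u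
  have "is_interval {m. u < upper m t}"
    unfolding is_interval_1 using upper_mono less_le_trans by blast
  then show "{m \<in> space borel. u < upper m t} \<in> sets borel"
    using real_interval_borel_measurable by simp
qed

text \<open>Between \<^term>\<open>\<mu>\<close> and the limit there are points of \<^term>\<open>Q\<close> at which the divergence from \<^term>\<open>\<mu>\<close> is
  strictly less than \<^term>\<open>s\<close>, by strict monotonicity, and above it every point of \<^term>\<open>Q\<close> has
  divergence strictly greater than \<^term>\<open>s\<close>. Strict inequalities at one fixed point persist under
  small changes of the first argument and of the level.\<close>

lemma tendsto_upper:
  assumes "\<mu> \<in> Q"
  shows "((\<lambda>(m, t). upper m t) \<longlongrightarrow> upper \<mu> s) (nhds \<mu> \<times>\<^sub>F nhds s)"
proof (rule order_tendstoI)
  have fst: "\<forall>\<^sub>F (m, t) in nhds \<mu> \<times>\<^sub>F nhds s. P m" if "\<forall>\<^sub>F m in nhds \<mu>. P m" for P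
    using eventually_prodI[OF that, of "\<lambda>_. True" "nhds s"] by (simp add: case_prod_unfold)
  have snd: "\<forall>\<^sub>F (m, t) in nhds \<mu> \<times>\<^sub>F nhds s. P t" if "\<forall>\<^sub>F t in nhds s. P t" for P
    using eventually_prodI[of "\<lambda>_. True" "nhds \<mu>", OF _ that] by (simp add: case_prod_unfold)
  {
    fix a assume a: "a < upper \<mu> s"
    show "\<forall>\<^sub>F x in nhds \<mu> \<times>\<^sub>F nhds s. a < (case x of (m, t) \<Rightarrow> upper m t)"
    proof (cases "a < ereal \<mu>")
      case True
      have "((\<lambda>m. ereal m) \<longlongrightarrow> ereal \<mu>) (nhds \<mu>)"
        by (intro tendsto_intros filterlim_ident)
      then have "\<forall>\<^sub>F m in nhds \<mu>. a < ereal m"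
        using True by (rule order_tendstoD)
      from fst[OF this] show ?thesis
        by eventually_elim (auto intro: less_le_trans[OF _ le_upper])
    next
      case False
      obtain q where q: "q \<in> Q" "\<mu> < q" "D \<mu> q \<le> s" "a < ereal q"
        using a False unfolding upper_def less_Sup_iff by auto
      \<comment> \<open>The strict inequality at a slightly smaller point survives perturbation.\<close>
      obtain r' where r': "a < r'" "r' < ereal q"
        using q(4) dense by blast
      from False r'(1) have "ereal \<mu> < r'"
        by (simp add: le_less_trans not_less)
      with r'(2) obtain r where r: "r' = ereal r" "\<mu> < r"
        by (cases r') auto
      have "r \<in> Q"
        using mem_is_interval_1_I[OF interval_Q assms q(1)] r r' by auto
      have "D \<mu> r < s"
        using strict_snd[OF assms \<open>r \<in> Q\<close> q(1)] r r' q(3) by auto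
      then obtain z where z: "D \<mu> r < z" "z < s"
        using dense by blast
      have "\<forall>\<^sub>F m in nhds \<mu>. D m r < z"
        using cont_fst[OF assms \<open>r \<in> Q\<close>] z(1) by (rule order_tendstoD)
      moreover have "\<forall>\<^sub>F m in nhds \<mu>. m < r"
        using order_tendstoD(2)[OF filterlim_ident r(2)] by simp
      moreover have "\<forall>\<^sub>F t in nhds s. z < t"
        using order_tendstoD(1)[OF filterlim_ident z(2)] by simp
      ultimately have "\<forall>\<^sub>F (m, t) in nhds \<mu> \<times>\<^sub>F nhds s. (D m r < z \<and> m < r) \<and> z < t"
        by (intro eventually_prodI[of "\<lambda>m. D m r < z \<and> m < r" _ "\<lambda>t. z < t", THEN eventually_mono])
           (auto intro: eventually_conj)
      then show ?thesis
        by eventually_elim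
           (use \<open>r \<in> Q\<close> r r' in \<open>auto intro!: less_le_trans[OF _ upper_member]\<close>)
    qed
  next
    fix a assume a: "upper \<mu> s < a"
    obtain r' where r': "upper \<mu> s < r'" "r' < a"
      using a dense by blast
    have "ereal \<mu> < r'"
      using r' le_upper le_less_trans by blast
    with r'(2) obtain r where r: "r' = ereal r" "\<mu> < r"
      by (cases r') auto
    have less: "\<forall>\<^sub>F m in nhds \<mu>. m < r"
      using order_tendstoD(2)[OF filterlim_ident r(2)] by simp
    show "\<forall>\<^sub>F x in nhds \<mu> \<times>\<^sub>F nhds s. (case x of (m, t) \<Rightarrow> upper m t) < a"
    proof (cases "r \<in> Q")
      case True
      have "s < D \<mu> r"
        using upper_member[OF True r(2), of s] r' r by (auto simp: not_less[symmetric])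
      then obtain z where z: "s < z" "z < D \<mu> r"
        using dense by blast
      have "\<forall>\<^sub>F m in nhds \<mu>. z < D m r"
        using cont_fst[OF assms True] z(2) by (rule order_tendstoD)
      moreover note less
      moreover have "\<forall>\<^sub>F t in nhds s. t < z"
        using order_tendstoD(2)[OF filterlim_ident z(1)] by simp
      moreover have "\<forall>\<^sub>F m in nhds \<mu>. m \<in> Q"
        using assms open_Q eventually_nhds_in_open by blast
      ultimately have "\<forall>\<^sub>F (m, t) in nhds \<mu> \<times>\<^sub>F nhds s. (z < D m r \<and> m < r \<and> m \<in> Q) \<and> t < z"
        by (intro eventually_prodI[of "\<lambda>m. z < D m r \<and> m < r \<and> m \<in> Q" _ "\<lambda>t. t < z", THEN eventually_mono])
           (auto intro: eventually_conj)
      then show ?thesis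
      proof eventually_elim
        case (elim x)
        obtain m t where x: "x = (m, t)" by force
        have "upper m t \<le> ereal r"
        proof (rule upper_least)
          fix q assume q: "q \<in> Q" "m < q" "D m q \<le> t"
          show "ereal q \<le> ereal r"
          proof (rule ccontr)
            assume "\<not> ereal q \<le> ereal r"
            then have "D m r < D m q"
              using elim True q x by (intro strict_snd) auto
            then show False using elim q x by auto
          qed
        qed (use elim x in auto)
        then show ?case using r r' x by auto
      qed
    next
      case False
      then have below: "q < r" if "q \<in> Q" for q
        using mem_is_interval_1_I[OF interval_Q assms that, of r] r(2) by force
      have "upper m t < a" if "m < r" for m t
        using upper_least[of m "ereal r" t] below that r r' by (force intro: le_less_trans)
      with fst[OF less] show ?thesis
        by (auto elim: eventually_mono)
    qed
  }
qed

end

section \<open>One-parameter exponential families\<close>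

locale exp_family =
  fixes \<xi> :: "real measure" and b :: "real \<Rightarrow> real"
  assumes exp_family: "exponential_family \<xi> b"
begin

abbreviation "\<Theta> \<equiv> param_set \<xi>"
abbreviation "P \<equiv> fam \<xi> b"
abbreviation "mean \<theta> \<equiv> mean_of (P \<theta>)"
abbreviation "Q \<equiv> means \<xi> b"

lemma sets_xi: "sets \<xi> = sets borel" and open_params: "open \<Theta>"
  and interval_params: "is_interval \<Theta>"
  and prob_space_P: "\<theta> \<in> \<Theta> \<Longrightarrow> prob_space (P \<theta>)"
  and b_differentiable: "\<theta> \<in> \<Theta> \<Longrightarrow> b differentiable (at \<theta>)"
  and deriv_b_differentiable: "\<theta> \<in> \<Theta> \<Longrightarrow> deriv b differentiable (at \<theta>)"
  and b_strictly_convex: "\<lbrakk>s \<in> \<Theta>; t \<in> \<Theta>; u \<in> {0<..<1}; s \<noteq> t\<rbrakk> \<Longrightarrow>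
        b (u * s + (1 - u) * t) < u * b s + (1 - u) * b t"
  using exp_family unfolding exponential_family_def by blast+

lemma measurable_xi [simp]: "measurable \<xi> M = measurable borel M"
  by (rule measurable_cong_sets[OF sets_xi refl])

lemma sets_P [simp]: "sets (P \<theta>) = sets borel"
  by (simp add: fam_def sets_xi)

lemma measurable_P [simp]: "measurable (P \<theta>) M = measurable borel M"
  by (rule measurable_cong_sets[OF sets_P refl])

lemma integrable_mean: "\<theta> \<in> \<Theta> \<Longrightarrow> integrable (P \<theta>) (\<lambda>x. x)"
proof -
  assume "\<theta> \<in> \<Theta>"
  then have "integrable \<xi> (\<lambda>x. exp (- b \<theta>) * (\<bar>x\<bar> * exp (\<theta> * x)))"
    by (simp add: param_set_def)
  also have "(\<lambda>x. exp (- b \<theta>) * (\<bar>x\<bar> * exp (\<theta> * x))) = (\<lambda>x. exp (\<theta> * x - b \<theta>) * \<bar>x\<bar>)"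
    by (simp add: exp_diff exp_minus field_simps)
  finally have "integrable (P \<theta>) (\<lambda>x. \<bar>x\<bar>)"
    unfolding fam_def by (subst integrable_real_density) auto
  then show ?thesis by (simp add: integrable_abs_iff)
qed

lemma density_P:
  "density (P \<theta>) (\<lambda>x. ennreal (exp ((\<theta>' - \<theta>) * x - (b \<theta>' - b \<theta>)))) = P \<theta>'"
  unfolding fam_def
  by (subst density_density_eq)
     (auto intro!: density_cong simp: ennreal_mult'[symmetric] exp_add[symmetric] algebra_simps)

text \<open>Within the parameter set, tilting one member by an exponential yields another member, so
  the moment generating function is the ratio of the two normalisations.\<close>

lemma exp_moment:
  assumes "\<theta> \<in> \<Theta>" "\<theta>' \<in> \<Theta>"
  shows "integrable (P \<theta>) (\<lambda>x. exp ((\<theta>' - \<theta>) * x))"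
    and "(\<integral>x. exp ((\<theta>' - \<theta>) * x) \<partial>P \<theta>) = exp (b \<theta>' - b \<theta>)"
proof -
  interpret P': prob_space "P \<theta>'" using assms prob_space_P by blast
  let ?d = "\<lambda>x. exp ((\<theta>' - \<theta>) * x - (b \<theta>' - b \<theta>))"
  have *: "?d x * exp (b \<theta>' - b \<theta>) = exp ((\<theta>' - \<theta>) * x)" for x
    by (simp add: exp_add[symmetric])
  have "integrable (P \<theta>) ?d"
    using integrable_real_density[of ?d "P \<theta>" "\<lambda>_. 1"] P'.integrable_const[of 1] by (simp add: density_P)
  from integrable_mult_left[OF this, of "exp (b \<theta>' - b \<theta>)"]
  show "integrable (P \<theta>) (\<lambda>x. exp ((\<theta>' - \<theta>) * x))" by (simp only: *)
  have "(\<integral>x. ?d x \<partial>P \<theta>) = 1"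
    using integral_real_density[of ?d "P \<theta>" "\<lambda>_. 1"] P'.prob_space by (simp add: density_P)
  then have "(\<integral>x. ?d x * exp (b \<theta>' - b \<theta>) \<partial>P \<theta>) = exp (b \<theta>' - b \<theta>)"
    by simp
  then show "(\<integral>x. exp ((\<theta>' - \<theta>) * x) \<partial>P \<theta>) = exp (b \<theta>' - b \<theta>)"
    by (simp only: *)
qed

text \<open>Integrating the tangent line of the exponential function at the mean gives Jensen's inequality.\<close>

lemma jensen_exp:
  assumes "\<theta> \<in> \<Theta>" "integrable (P \<theta>) (\<lambda>x. exp (l * x + c))"
  shows "exp (l * mean \<theta> + c) \<le> (\<integral>x. exp (l * x + c) \<partial>P \<theta>)"
proof -
  interpret prob_space "P \<theta>" using assms prob_space_P by blast
  let ?y = "l * mean \<theta> + c"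
  have tangent: "exp ?y * (1 + (l * x + c - ?y)) \<le> exp (l * x + c)" for x
  proof -
    have "exp ?y * (1 + (l * x + c - ?y)) \<le> exp ?y * exp (l * x + c - ?y)"
      using exp_ge_add_one_self by (intro mult_left_mono) auto
    also have "\<dots> = exp (?y + (l * x + c - ?y))" by (rule exp_add[symmetric])
    also have "?y + (l * x + c - ?y) = l * x + c" by simp
    finally show ?thesis .
  qed
  have "(\<integral>x. exp ?y * (1 + (l * x + c - ?y)) \<partial>P \<theta>) \<le> (\<integral>x. exp (l * x + c) \<partial>P \<theta>)"
    using assms integrable_mean[OF assms(1)] tangent by (intro integral_mono) auto
  moreover have "(\<integral>x. exp ?y * (1 + (l * x + c - ?y)) \<partial>P \<theta>) = exp ?y"
    using integrable_mean[OF assms(1)] by (simp add: prob_space mean_of_def)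
  ultimately show ?thesis by simp
qed

text \<open>The ratio of normalisations \<^term>\<open>exp (b \<theta>' - b \<theta>)\<close> is an exponential moment, so Jensen's
  inequality bounds it from below.\<close>

lemma b_tangent:
  assumes "\<theta> \<in> \<Theta>" "\<theta>' \<in> \<Theta>"
  shows "b \<theta> + (\<theta>' - \<theta>) * mean \<theta> \<le> b \<theta>'"
  using jensen_exp[of \<theta> "\<theta>' - \<theta>" 0] exp_moment[OF assms] assms by simp

text \<open>If the tangent touched \<^term>\<open>b\<close> a second time, strict convexity would put \<^term>\<open>b\<close> below the
  tangent at the midpoint.\<close>

lemma b_tangent_strict:
  assumes "\<theta> \<in> \<Theta>" "\<theta>' \<in> \<Theta>" "\<theta> \<noteq> \<theta>'"
  shows "b \<theta> + (\<theta>' - \<theta>) * mean \<theta> < b \<theta>'"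
proof -
  let ?m = "1/2 * \<theta> + (1 - 1/2) * \<theta>'"
  have "?m \<in> closed_segment \<theta> \<theta>'"
    by (auto simp: closed_segment_def intro!: exI[of _ "1/2"])
  then have "?m \<in> \<Theta>"
    using interval_params assms is_interval_convex convex_contains_segment by blast
  then have "b \<theta> + (?m - \<theta>) * mean \<theta> \<le> b ?m"
    using assms by (intro b_tangent)
  also have "b ?m < 1/2 * b \<theta> + (1 - 1/2) * b \<theta>'"
    using assms by (intro b_strictly_convex) auto
  finally show ?thesis by (simp add: algebra_simps)
qed

lemma mean_strict_mono:
  assumes "\<theta> \<in> \<Theta>" "\<theta>' \<in> \<Theta>" "\<theta> < \<theta>'"
  shows "mean \<theta> < mean \<theta>'"
proof -
  have "b \<theta> + (\<theta>' - \<theta>) * mean \<theta> + (\<theta> - \<theta>') * mean \<theta>' < b \<theta>' + (\<theta> - \<theta>') * mean \<theta>'"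
    using b_tangent_strict[of \<theta> \<theta>'] assms by simp
  also have "\<dots> \<le> b \<theta>"
    using b_tangent[of \<theta>' \<theta>] assms by simp
  finally have "(\<theta>' - \<theta>) * mean \<theta> < (\<theta>' - \<theta>) * mean \<theta>'"
    by (simp add: algebra_simps)
  then show ?thesis using assms by simp
qed

lemma mean_less_iff: "\<lbrakk>\<theta> \<in> \<Theta>; \<theta>' \<in> \<Theta>\<rbrakk> \<Longrightarrow> mean \<theta> < mean \<theta>' \<longleftrightarrow> \<theta> < \<theta>'"
  by (metis mean_strict_mono not_less_iff_gr_or_eq)

lemma mean_le_iff: "\<lbrakk>\<theta> \<in> \<Theta>; \<theta>' \<in> \<Theta>\<rbrakk> \<Longrightarrow> mean \<theta> \<le> mean \<theta>' \<longleftrightarrow> \<theta> \<le> \<theta>'"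
  using mean_less_iff by (metis not_less)

lemma inj_on_mean: "inj_on mean \<Theta>"
  by (rule linorder_inj_onI) (use mean_strict_mono in \<open>force+\<close>)

text \<open>The mean is a subgradient of \<^term>\<open>b\<close> by Jensen's inequality, hence its derivative.\<close>

lemma mean_eq_deriv:
  assumes "\<theta> \<in> \<Theta>"
  shows "mean \<theta> = deriv b \<theta>"
proof -
  let ?f = "\<lambda>t. b t - (b \<theta> + (t - \<theta>) * mean \<theta>)"
  have "DERIV b \<theta> :> deriv b \<theta>"
    using b_differentiable[OF assms] by (simp add: DERIV_deriv_iff_real_differentiable)
  then have "DERIV ?f \<theta> :> deriv b \<theta> - mean \<theta>"
    by (auto intro!: derivative_eq_intros)
  moreover obtain e where e: "e > 0" "ball \<theta> e \<subseteq> \<Theta>"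
    using open_params assms open_contains_ball by blast
  have "\<forall>t. \<bar>\<theta> - t\<bar> < e \<longrightarrow> ?f \<theta> \<le> ?f t"
    using e b_tangent[OF assms] by (auto simp: subset_iff dist_real_def)
  ultimately have "deriv b \<theta> - mean \<theta> = 0"
    using \<open>e > 0\<close> DERIV_local_min by blast
  then show ?thesis by simp
qed

lemma continuous_on_b: "continuous_on \<Theta> b"
  using b_differentiable by (auto intro!: continuous_at_imp_continuous_on differentiable_imp_continuous_within)

lemma continuous_on_mean: "continuous_on \<Theta> mean"
proof -
  have "continuous_on \<Theta> (deriv b)"
    using deriv_b_differentiable
    by (auto intro!: continuous_at_imp_continuous_on differentiable_imp_continuous_within)
  then show ?thesis
    using continuous_on_cong[OF refl, of \<Theta> mean "deriv b"] mean_eq_deriv by simp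
qed

lemma means_eq: "Q = mean ` \<Theta>"
  by (simp add: means_def family_def image_image)

lemma interval_means: "is_interval Q"
  using continuous_on_mean interval_params connected_continuous_image
  by (auto simp: means_eq is_interval_connected_1)

lemma open_means: "open Q"
  unfolding means_eq
  using continuous_on_mean open_params inj_on_mean by (rule invariance_of_domain)

definition param :: "real \<Rightarrow> real" where
  "param = param_of_mean \<xi> b"

lemma param:
  assumes "q \<in> Q"
  shows "param q \<in> \<Theta>" "mean (param q) = q"
  using assms the_inv_into_into[OF inj_on_mean _ subset_refl] f_the_inv_into_f[OF inj_on_mean]
  by (auto simp: param_def param_of_mean_def means_eq)

lemma param_mean: "\<theta> \<in> \<Theta> \<Longrightarrow> param (mean \<theta>) = \<theta>"
  using the_inv_into_f_f[OF inj_on_mean] by (simp add: param_def param_of_mean_def)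

lemma param_less_iff: "\<lbrakk>q \<in> Q; r \<in> Q\<rbrakk> \<Longrightarrow> param q < param r \<longleftrightarrow> q < r"
  using mean_less_iff param by metis

abbreviation "D \<equiv> dvg \<xi> b"

text \<open>Members of the family have exponential densities with respect to each other, so the logarithm in
  the Kullback-Leibler divergence is affine.\<close>

lemma dvg_eq:
  assumes "y \<in> Q" "q \<in> Q"
  shows "D y q = ereal ((param y - param q) * y - (b (param y) - b (param q)))"
proof -
  interpret Pq: prob_space "P (param q)" using assms param prob_space_P by blast
  interpret Py: prob_space "P (param y)" using assms param prob_space_P by blast
  let ?l = "param y - param q" and ?c = "b (param y) - b (param q)"
  have "KL_divergence (exp 1) (P (param q)) (P (param y))
      = (\<integral>x. exp (?l * x - ?c) * log (exp 1) (exp (?l * x - ?c)) \<partial>P (param q))"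
    using Pq.KL_density[of "exp 1" "\<lambda>x. exp (?l * x - ?c)"] by (simp add: density_P)
  also have "\<dots> = (\<integral>x. exp (?l * x - ?c) * (?l * x - ?c) \<partial>P (param q))"
    by (simp add: log_def)
  also have "\<dots> = (\<integral>x. ?l * x - ?c \<partial>P (param y))"
    using integral_real_density[of "\<lambda>x. exp (?l * x - ?c)" "P (param q)" "\<lambda>x. ?l * x - ?c"]
    by (simp add: density_P)
  also have "\<dots> = ?l * y - ?c"
    using integrable_mean[of "param y"] param[OF assms(1)] Py.prob_space
    by (simp add: mean_of_def)
  finally show ?thesis
    using assms by (simp add: dvg_def param_def)
qed

lemma log_mgf_ge:
  assumes "q \<in> Q"
  shows "ereal (l * q) \<le> log_mgf (P (param q)) l"
proof (cases "integrable (P (param q)) (\<lambda>x. exp (l * x))")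
  case True
  have "exp (l * q) \<le> (\<integral>x. exp (l * x) \<partial>P (param q))"
    using jensen_exp[of "param q" l 0] True param[OF assms] by simp
  then have "l * q \<le> ln (\<integral>x. exp (l * x) \<partial>P (param q))"
    using less_le_trans[OF exp_gt_zero] by (subst ln_ge_iff) auto
  then show ?thesis using True by (simp add: log_mgf_def)
qed (simp add: log_mgf_def)

text \<open>The variational formula for the divergence: the supremum is attained at the tilt that
  carries the second distribution to the first, and no other exponential moment, including those
  outside the parameter set, can give more by Jensen's inequality under the first distribution.\<close>

lemma dvg_eq_SUP:
  assumes "q \<in> Q"
  shows "D y q = (SUP l. ereal (l * y) - log_mgf (P (param q)) l)"
proof (cases "y \<in> Q")
  case True
  let ?l = "param y - param q" and ?c = "b (param y) - b (param q)"
  note y = param[OF True] and q = param[OF assms]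
  interpret Py: prob_space "P (param y)" using y prob_space_P by blast
  have "D y q \<le> (SUP l. ereal (l * y) - log_mgf (P (param q)) l)"
    using exp_moment[OF q(1) y(1)] by (intro SUP_upper2[of ?l]) (auto simp: log_mgf_def dvg_eq True assms)
  moreover have "ereal (l * y) - log_mgf (P (param q)) l \<le> D y q" for l
  proof (cases "integrable (P (param q)) (\<lambda>x. exp (l * x))")
    case int: True
    have eq: "exp (?l * x - ?c) * exp ((l - ?l) * x + ?c) = exp (l * x)" for x
      by (simp add: exp_add[symmetric] algebra_simps)
    have "integrable (P (param y)) (\<lambda>x. exp ((l - ?l) * x + ?c))"
      using integrable_real_density[of "\<lambda>x. exp (?l * x - ?c)" "P (param q)" "\<lambda>x. exp ((l - ?l) * x + ?c)"] int
      by (simp add: density_P eq)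
    then have "exp ((l - ?l) * y + ?c) \<le> (\<integral>x. exp ((l - ?l) * x + ?c) \<partial>P (param y))"
      using jensen_exp[of "param y" "l - ?l" ?c] y by simp
    also have "\<dots> = (\<integral>x. exp (l * x) \<partial>P (param q))"
      using integral_real_density[of "\<lambda>x. exp (?l * x - ?c)" "P (param q)" "\<lambda>x. exp ((l - ?l) * x + ?c)"]
      by (simp add: density_P eq)
    finally have "(l - ?l) * y + ?c \<le> ln (\<integral>x. exp (l * x) \<partial>P (param q))"
      using less_le_trans[OF exp_gt_zero] by (subst ln_ge_iff) auto
    then show ?thesis
      using int by (simp add: log_mgf_def dvg_eq True assms algebra_simps)
  qed (simp add: log_mgf_def)
  then have "(SUP l. ereal (l * y) - log_mgf (P (param q)) l) \<le> D y q"
    by (rule SUP_least)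
  ultimately show ?thesis by (rule antisym)
qed (simp add: dvg_def param_def)

lemma log_mgf_0: "q \<in> Q \<Longrightarrow> log_mgf (P (param q)) 0 = 0"
proof -
  assume "q \<in> Q"
  then interpret prob_space "P (param q)" using param prob_space_P by blast
  show ?thesis by (simp add: log_mgf_def prob_space zero_ereal_def)
qed

lemma dvg_nonneg: "q \<in> Q \<Longrightarrow> 0 \<le> D y q"
  unfolding dvg_eq_SUP by (intro SUP_upper2[of 0]) (auto simp: log_mgf_0)

text \<open>If \<^term>\<open>y'\<close> lies between \<^term>\<open>y\<close> and \<^term>\<open>q\<close>, a tilt pointing from
  \<^term>\<open>y\<close> to \<^term>\<open>q\<close> contributes nothing positive to the supremum at \<^term>\<open>y'\<close>, and every
  other tilt contributes at least as much at \<^term>\<open>y\<close>.\<close>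

lemma dvg_antimono_between:
  assumes "q \<in> Q" "(y \<le> y' \<and> y' \<le> q) \<or> (q \<le> y' \<and> y' \<le> y)"
  shows "D y' q \<le> D y q"
  unfolding dvg_eq_SUP[OF assms(1), of y']
proof (rule SUP_least)
  fix l
  show "ereal (l * y') - log_mgf (P (param q)) l \<le> D y q"
  proof (cases "l * y' \<le> l * y")
    case True
    then have "ereal (l * y') - log_mgf (P (param q)) l \<le> ereal (l * y) - log_mgf (P (param q)) l"
      by (intro ereal_minus_mono) auto
    also have "\<dots> \<le> D y q"
      unfolding dvg_eq_SUP[OF assms(1)] by (intro SUP_upper) auto
    finally show ?thesis .
  next
    case False
    then have "l * y' \<le> l * q"
      using assms(2) by (auto simp: mult_le_cancel_left)
    then have "ereal (l * y') \<le> log_mgf (P (param q)) l"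
      using log_mgf_ge[OF assms(1), of l] order_trans by (metis ereal_less_eq(3))
    then have "ereal (l * y') - log_mgf (P (param q)) l \<le> 0"
      by (cases "log_mgf (P (param q)) l") auto
    then show ?thesis using dvg_nonneg[OF assms(1)] by (rule order_trans)
  qed
qed

lemma dvg_self: "q \<in> Q \<Longrightarrow> D q q = 0"
  by (simp add: dvg_eq zero_ereal_def)

text \<open>Passing from \<^term>\<open>q\<close> to \<^term>\<open>r\<close> changes the divergence by the divergence from
  \<^term>\<open>q\<close> to \<^term>\<open>r\<close>, which is positive, plus a product that is nonnegative, as
  the steps from \<^term>\<open>y\<close> to \<^term>\<open>q\<close> and from there to \<^term>\<open>r\<close> have the same direction.\<close>

lemma dvg_strict_snd:
  assumes "y \<in> Q" "q \<in> Q" "r \<in> Q" "(y \<le> q \<and> q < r) \<or> (r < q \<and> q \<le> y)"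
  shows "D y q < D y r"
proof -
  have "q \<noteq> r" using assms by auto
  then have "param q \<noteq> param r" using param(2) assms by metis
  then have "b (param q) + (param r - param q) * q < b (param r)"
    using b_tangent_strict[of "param q" "param r"] param assms by simp
  moreover have "0 \<le> (param r - param q) * (q - y)"
    using assms(4) param_less_iff[OF assms(2,3)] param_less_iff[OF assms(3,2)]
    by (auto simp: zero_le_mult_iff)
  ultimately show ?thesis
    using assms by (simp add: dvg_eq algebra_simps)
qed

text \<open>As a function of its first argument the divergence is a supremum of affine functions, hence
  convex, and convex functions are continuous on open intervals.\<close>

lemma dvg_cont_fst:
  assumes "y \<in> Q" "q \<in> Q"
  shows "((\<lambda>y. D y q) \<longlongrightarrow> D y q) (nhds y)"
proof -
  let ?f = "\<lambda>y. (param y - param q) * y - (b (param y) - b (param q))"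
  have "convex_on Q ?f"
  proof (rule convex_onI)
    fix t x z :: real assume *: "0 < t" "t < 1" "x \<in> Q" "z \<in> Q"
    let ?w = "(1 - t) *\<^sub>R x + t *\<^sub>R z"
    have "?w \<in> Q"
      using interval_means * is_interval_convex[of Q] by (auto simp: convex_alt)
    have sub: "(param ?w - param q) * v - (b (param ?w) - b (param q)) \<le> ?f v" if "v \<in> Q" for v
      using b_tangent[of "param v" "param ?w"] param[OF that] param[OF \<open>?w \<in> Q\<close>]
      by (simp add: algebra_simps)
    have "?f ?w = (1 - t) * ((param ?w - param q) * x - (b (param ?w) - b (param q)))
        + t * ((param ?w - param q) * z - (b (param ?w) - b (param q)))"
      by (simp add: algebra_simps)
    also have "\<dots> \<le> (1 - t) * ?f x + t * ?f z"
      using * sub by (intro add_mono mult_left_mono) auto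
    finally show "?f ?w \<le> (1 - t) * ?f x + t * ?f z" .
  qed (use interval_means is_interval_convex in auto)
  then have "continuous_on Q ?f"
    using open_means convex_on_continuous by blast
  then have "(?f \<longlongrightarrow> ?f y) (nhds y)"
    using assms open_means by (simp add: continuous_on_eq_continuous_at isCont_def tendsto_nhds_iff)
  then have "((\<lambda>y. ereal (?f y)) \<longlongrightarrow> ereal (?f y)) (nhds y)"
    by (rule tendsto_ereal)
  then have "((\<lambda>y. ereal (?f y)) \<longlongrightarrow> D y q) (nhds y)"
    using assms by (simp add: dvg_eq)
  moreover have "\<forall>\<^sub>F y in nhds y. ereal (?f y) = D y q"
    using eventually_nhds_in_open[OF open_means assms(1)]
    by eventually_elim (simp add: dvg_eq assms)
  ultimately show ?thesis
    by (rule Lim_transform_eventually)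
qed

text \<open>This is the intermediate value theorem in the parameter, as a function of which the divergence
  from \<^term>\<open>\<mu>\<close> is \<^term>\<open>b\<close> plus an affine function.\<close>

lemma dvg_level_attained:
  assumes "\<mu> \<in> Q" "q \<in> Q" "0 < c" "ereal c \<le> D \<mu> q"
  shows "\<exists>r\<in>Q. r \<in> closed_segment \<mu> q \<and> r \<noteq> \<mu> \<and> D \<mu> r = ereal c"
proof -
  let ?g = "\<lambda>t. (param \<mu> - t) * \<mu> - (b (param \<mu>) - b t)"
  have seg: "closed_segment (param \<mu>) (param q) \<subseteq> \<Theta>"
    using interval_params param(1)[OF assms(1)] param(1)[OF assms(2)]
    by (simp add: is_interval_convex closed_segment_subset)
  have "continuous_on (closed_segment (param \<mu>) (param q)) ?g"
    by (intro continuous_intros continuous_on_subset[OF continuous_on_b seg])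
  then have "connected (?g ` closed_segment (param \<mu>) (param q))"
    by (intro connected_continuous_image) auto
  moreover have "?g (param \<mu>) \<le> c" "c \<le> ?g (param q)"
    using assms by (auto simp: dvg_eq)
  ultimately have "c \<in> ?g ` closed_segment (param \<mu>) (param q)"
    by (rule connectedD_interval[OF _ imageI[OF ends_in_segment(1)] imageI[OF ends_in_segment(2)]])
  then obtain t where t: "t \<in> closed_segment (param \<mu>) (param q)" "?g t = c"
    by auto
  then have "t \<in> \<Theta>" using seg by blast
  have "mean t \<in> Q" using \<open>t \<in> \<Theta>\<close> by (auto simp: means_eq)
  moreover have "mean t \<in> closed_segment \<mu> q"
  proof -
    have "param \<mu> \<le> t \<and> t \<le> param q \<or> param q \<le> t \<and> t \<le> param \<mu>"
      using t(1) by (auto simp: closed_segment_eq_real_ivl split: if_splits)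
    then have "\<mu> \<le> mean t \<and> mean t \<le> q \<or> q \<le> mean t \<and> mean t \<le> \<mu>"
      using mean_le_iff \<open>t \<in> \<Theta>\<close> param[OF assms(1)] param[OF assms(2)] by metis
    then show ?thesis
      by (auto simp: closed_segment_eq_real_ivl)
  qed
  moreover have "mean t \<noteq> \<mu>"
    using t(2) assms(3) param_mean[OF \<open>t \<in> \<Theta>\<close>] by auto
  moreover have "D \<mu> (mean t) = ereal c"
    using t(2) \<open>mean t \<in> Q\<close> assms(1) param_mean[OF \<open>t \<in> \<Theta>\<close>] by (simp add: dvg_eq)
  ultimately show ?thesis by blast
qed

end

section \<open>Endpoints and coverage of the policy\<close>

context exp_family
begin

lemma iid_reals_P: "\<theta> \<in> \<Theta> \<Longrightarrow> iid_reals (P \<theta>)"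
  by (simp add: iid_reals_def iid_reals_axioms_def prob_space_P)

text \<open>The tilt \<^term>\<open>0::real\<close> contributes \<^term>\<open>0::real\<close> to the supremum that defines the divergence, so a
  value above \<^term>\<open>t\<close> comes from a positive or from a negative tilt. A measurable superset is
  used since only an upper bound matters.\<close>

lemma dvg_concentration:
  assumes "\<theta> \<in> \<Theta>" "0 < n" "0 \<le> t"
  shows "\<exists>H\<in>sets (iid_reals.law (P \<theta>)). measure (iid_reals.law (P \<theta>)) H \<le> 2 * exp (- (real n * t))
    \<and> {x \<in> space (iid_reals.law (P \<theta>)). ereal t < D (emp_mean n x) (mean \<theta>)} \<subseteq> H"
proof -
  interpret iid_reals "P \<theta>" using assms(1) by (rule iid_reals_P)
  define H where "H s = {x \<in> space law. \<exists>l. 0 < l * s \<and> integrable (P \<theta>) (\<lambda>x. exp (l * x)) \<and>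
      t < l * emp_mean n x - ln (\<integral>x. exp (l * x) \<partial>P \<theta>)}" for s :: real
  have H: "H s \<in> sets law" "S.prob (H s) \<le> exp (- (real n * t))" if "s = 1 \<or> s = - 1" for s
    unfolding H_def using chernoff_all_tilts[OF that assms(2)] by auto
  have mean: "mean \<theta> \<in> Q" using assms(1) by (simp add: means_eq)
  have "{x \<in> space law. ereal t < D (emp_mean n x) (mean \<theta>)} \<subseteq> H 1 \<union> H (- 1)"
  proof clarify
    fix x assume x: "x \<in> space law" "ereal t < D (emp_mean n x) (mean \<theta>)" "x \<notin> H (- 1)"
    then obtain l where l: "ereal t < ereal (l * emp_mean n x) - log_mgf (P \<theta>) l"
      unfolding dvg_eq_SUP[OF mean] param_mean[OF assms(1)] less_SUP_iff by auto
    then have "integrable (P \<theta>) (\<lambda>x. exp (l * x))"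
      by (auto simp: log_mgf_def split: if_splits)
    moreover from this l have "t < l * emp_mean n x - ln (\<integral>x. exp (l * x) \<partial>P \<theta>)"
      by (simp add: log_mgf_def)
    moreover have "l \<noteq> 0"
      using l log_mgf_0[OF mean] assms(3) by (auto simp: param_mean[OF assms(1)])
    ultimately show "x \<in> H 1"
      using x(1,3) by (cases "0 < l") (auto simp: H_def)
  qed
  moreover have "S.prob (H 1 \<union> H (- 1)) \<le> 2 * exp (- (real n * t))"
    using measure_Un_le[of "H 1" law "H (- 1)"] H[of 1] H[of "- 1"] by simp
  ultimately show ?thesis
    using H by (intro bexI[of _ "H 1 \<union> H (- 1)"]) auto
qed

sublocale R: right_divergence Q D
proof
  show "D y' q \<le> D y q" if "q \<in> Q" "y \<le> y'" "y' \<le> q" for q y y'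
    using that by (intro dvg_antimono_between) auto
  show "D y q < D y r" if "y \<in> Q" "q \<in> Q" "r \<in> Q" "y \<le> q" "q < r" for y q r
    using that by (intro dvg_strict_snd) auto
qed (auto intro: open_means interval_means dvg_cont_fst)

sublocale L: right_divergence "uminus ` Q" "\<lambda>y q. D (- y) (- q)"
proof
  show "open (uminus ` Q)"
    using open_means by (rule open_negations)
  show "is_interval (uminus ` Q)"
    using interval_means by simp
  show "D (- y') (- q) \<le> D (- y) (- q)" if "q \<in> uminus ` Q" "y \<le> y'" "y' \<le> q" for q y y'
    using that by (intro dvg_antimono_between) auto
  show "D (- y) (- q) < D (- y) (- r)"
    if "y \<in> uminus ` Q" "q \<in> uminus ` Q" "r \<in> uminus ` Q" "y \<le> q" "q < r" for y q r
    using that by (intro dvg_strict_snd) auto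
  show "((\<lambda>y. D (- y) (- q)) \<longlongrightarrow> D (- y) (- q)) (nhds y)" if "y \<in> uminus ` Q" "q \<in> uminus ` Q" for y q
  proof -
    have "- y \<in> Q" "- q \<in> Q" using that by auto
    have "filterlim uminus (nhds (- y)) (nhds y)"
      by (intro tendsto_minus filterlim_ident)
    with dvg_cont_fst[OF \<open>- y \<in> Q\<close> \<open>- q \<in> Q\<close>] show ?thesis
      by (rule filterlim_compose)
  qed
qed

definition lower :: "real \<Rightarrow> ereal \<Rightarrow> ereal" where
  "lower m t = - L.upper (- m) t"

lemma lower_eq: "lower m t = Inf (ereal ` insert m {q \<in> Q. q < m \<and> D m q \<le> t})"
proof -
  let ?A = "insert m {q \<in> Q. q < m \<and> D m q \<le> t}"
  have "insert (- m) {q \<in> uminus ` Q. - m < q \<and> D (- (- m)) (- q) \<le> t} = uminus ` ?A"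
    by auto
  then have "L.upper (- m) t = Sup (ereal ` uminus ` ?A)"
    by (simp only: L.upper_def)
  also have "ereal ` uminus ` ?A = uminus ` ereal ` ?A"
    by (auto simp: image_image)
  also have "Sup \<dots> = - Inf (ereal ` ?A)"
    by (rule ereal_Sup_uminus_image_eq)
  finally show ?thesis
    by (simp add: lower_def)
qed

lemma lower_le: "lower m t \<le> ereal m"
  unfolding lower_eq by (intro Inf_lower) auto

lemma lower_member: "\<lbrakk>q \<in> Q; q < m; D m q \<le> t\<rbrakk> \<Longrightarrow> lower m t \<le> ereal q"
  unfolding lower_eq by (intro Inf_lower) auto

lemma borel_measurable_lower: "(\<lambda>m. lower m t) \<in> borel_measurable borel"
  unfolding lower_def using L.borel_measurable_upper[of t] by measurable

lemma tendsto_lower: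
  assumes "\<mu> \<in> Q"
  shows "((\<lambda>(m, t). lower m t) \<longlongrightarrow> lower \<mu> s) (nhds \<mu> \<times>\<^sub>F nhds s)"
proof -
  have "filterlim (\<lambda>x. (- fst x, snd x)) (nhds (- \<mu>) \<times>\<^sub>F nhds s) (nhds \<mu> \<times>\<^sub>F nhds s)"
    by (intro filterlim_Pair tendsto_minus filterlim_fst filterlim_snd)
  from filterlim_compose[OF L.tendsto_upper this]
  have "((\<lambda>x. L.upper (- fst x) (snd x)) \<longlongrightarrow> L.upper (- \<mu>) s) (nhds \<mu> \<times>\<^sub>F nhds s)"
    using assms by simp
  then show ?thesis
    unfolding lower_def case_prod_unfold by (rule tendsto_uminus_ereal)
qed

lemma threshold_iff:
  assumes "0 < n"
  shows "ereal (real n) * d \<le> ereal \<beta> \<longleftrightarrow> d \<le> ereal (\<beta> / real n)"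
  using ereal_le_divide_pos[of "ereal (real n)" d "ereal \<beta>"] assms by simp

lemma kl_right_eq:
  assumes "0 < n"
  shows "kl_right \<xi> b n \<delta> x = R.upper (emp_mean n x) (ereal (beta_thr n \<delta> / real n))"
proof -
  define A where "A = {q \<in> Q. emp_mean n x < q \<and> D (emp_mean n x) q \<le> ereal (beta_thr n \<delta> / real n)}"
  have "kl_right \<xi> b n \<delta> x = (if A = {} then ereal (emp_mean n x) else Sup (ereal ` A))"
    using assms unfolding kl_right_def Let_def threshold_iff[OF assms] A_def by (subst if_not_P) auto
  moreover have "R.upper (emp_mean n x) (ereal (beta_thr n \<delta> / real n)) = max (ereal (emp_mean n x)) (Sup (ereal ` A))"
    by (simp add: R.upper_def A_def)
  moreover have "ereal (emp_mean n x) \<le> Sup (ereal ` A)" if ne: "A \<noteq> {}"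
  proof -
    obtain q where "q \<in> A" using ne by blast
    then show ?thesis by (intro Sup_upper2[of "ereal q"]) (auto simp: A_def)
  qed
  ultimately show ?thesis
    by (cases "A = {}") (simp_all add: max_absorb2 bot_ereal_def)
qed

lemma kl_left_eq:
  assumes "0 < n"
  shows "kl_left \<xi> b n \<delta> x = lower (emp_mean n x) (ereal (beta_thr n \<delta> / real n))"
proof -
  define A where "A = {q \<in> Q. q < emp_mean n x \<and> D (emp_mean n x) q \<le> ereal (beta_thr n \<delta> / real n)}"
  have "kl_left \<xi> b n \<delta> x = (if A = {} then ereal (emp_mean n x) else Inf (ereal ` A))"
    using assms unfolding kl_left_def Let_def threshold_iff[OF assms] A_def by (subst if_not_P) auto
  moreover have "lower (emp_mean n x) (ereal (beta_thr n \<delta> / real n)) = min (ereal (emp_mean n x)) (Inf (ereal ` A))"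
    by (simp add: lower_eq A_def)
  moreover have "Inf (ereal ` A) \<le> ereal (emp_mean n x)" if ne: "A \<noteq> {}"
  proof -
    obtain q where "q \<in> A" using ne by blast
    then show ?thesis by (intro Inf_lower2[of "ereal q"]) (auto simp: A_def)
  qed
  ultimately show ?thesis
    by (cases "A = {}") (simp_all add: min_absorb2 top_ereal_def)
qed

lemma emp_mean_restrict: "emp_mean n (restrict x {..<n}) = emp_mean n x"
  by (simp add: emp_mean_def)

lemma is_policy_kl_policy:
  assumes "Q \<noteq> {}"
  shows "is_policy (kl_policy \<xi> b)"
  unfolding is_policy_def
proof (intro allI ballI)
  fix n \<delta>
  have [measurable]: "emp_mean n \<in> borel_measurable (\<Pi>\<^sub>M i\<in>{..<n}. borel)"
    unfolding emp_mean_def by measurable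
  show "fst (kl_policy \<xi> b) n \<delta> \<in> borel_measurable (\<Pi>\<^sub>M i\<in>{..<n}. borel) \<and>
      snd (kl_policy \<xi> b) n \<delta> \<in> borel_measurable (\<Pi>\<^sub>M i\<in>{..<n}. borel) \<and>
      (\<forall>x\<in>space (\<Pi>\<^sub>M i\<in>{..<n}. borel). fst (kl_policy \<xi> b) n \<delta> x \<le> snd (kl_policy \<xi> b) n \<delta> x)"
  proof (cases "n = 0")
    case True
    obtain q where "q \<in> Q" using assms by blast
    then have "Inf (ereal ` Q) \<le> Sup (ereal ` Q)"
      by (intro Inf_le_Sup) auto
    then show ?thesis
      using True by (simp add: kl_policy_def kl_left_def[abs_def] kl_right_def[abs_def])
  next
    case False
    have "lower m t \<le> R.upper m t" for m t
      using lower_le R.le_upper by (rule order_trans)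
    moreover have "(\<lambda>x. lower (emp_mean n x) t) \<in> borel_measurable (\<Pi>\<^sub>M i\<in>{..<n}. borel)"
      "(\<lambda>x. R.upper (emp_mean n x) t) \<in> borel_measurable (\<Pi>\<^sub>M i\<in>{..<n}. borel)" for t
      by (rule measurable_compose[OF _ borel_measurable_lower], measurable)
         (rule measurable_compose[OF _ R.borel_measurable_upper], measurable)
    moreover have "kl_right \<xi> b n \<delta> = (\<lambda>x. R.upper (emp_mean n x) (ereal (beta_thr n \<delta> / real n)))"
      "kl_left \<xi> b n \<delta> = (\<lambda>x. lower (emp_mean n x) (ereal (beta_thr n \<delta> / real n)))"
      using False by (auto simp: kl_left_eq kl_right_eq fun_eq_iff)
    ultimately show ?thesis
      by (simp add: kl_policy_def)
  qed
qed

text \<open>On whichever side of the empirical mean \<^term>\<open>\<mu>\<close> lies, it belongs to the set that defines the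
  endpoint on that side unless the threshold excludes it.\<close>

lemma miss_imp_dvg_large:
  assumes "0 < n" "\<mu> \<in> Q" "\<not> (kl_left \<xi> b n \<delta> x \<le> ereal \<mu> \<and> ereal \<mu> \<le> kl_right \<xi> b n \<delta> x)"
  shows "ereal (beta_thr n \<delta> / real n) < D (emp_mean n x) \<mu>"
proof (rule ccontr)
  let ?m = "emp_mean n x" and ?t = "ereal (beta_thr n \<delta> / real n)"
  assume "\<not> ?t < D ?m \<mu>"
  then have le: "D ?m \<mu> \<le> ?t" by simp
  have "lower ?m ?t \<le> ereal \<mu> \<and> ereal \<mu> \<le> R.upper ?m ?t"
  proof (cases ?m \<mu> rule: linorder_cases)
    case less
    then show ?thesis
      using R.upper_member[OF assms(2) less le] order_trans[OF lower_le, of ?m "ereal \<mu>" ?t] by simp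
  next
    case equal
    then show ?thesis using lower_le[of ?m ?t] R.le_upper[of ?m ?t] by simp
  next
    case greater
    then show ?thesis
      using lower_member[OF assms(2) greater le] order_trans[OF _ R.le_upper, of "ereal \<mu>" ?m ?t] by simp
  qed
  then show False
    using assms by (simp add: kl_left_eq kl_right_eq)
qed

text \<open>At each sample size the deviation bound is at most
  \<^term>\<open>2 * exp (- ln (2 / \<delta>)) = (\<delta>::real)\<close>, and independence of samples and costs carries it over to
  the random sample size.\<close>

lemma kl_policy_in_ci_policies:
  assumes "prob_space C" "sets C = sets borel" "\<Theta> \<noteq> {}"
  shows "kl_policy \<xi> b \<in> ci_policies \<xi> b C budget"
  unfolding ci_policies_def mem_Collect_eq
proof (intro conjI ballI)
  have "Q \<noteq> {}" using assms(3) by (auto simp: means_eq)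
  then show policy: "is_policy (kl_policy \<xi> b)" by (rule is_policy_kl_policy)
  interpret Y: iid_reals C
    using assms by (simp add: iid_reals_def iid_reals_axioms_def)
  fix \<nu> \<delta> assume "\<nu> \<in> family \<xi> b" and \<delta>: "\<delta> \<in> {0<..<1::real}"
  then obtain \<theta> where \<theta>: "\<theta> \<in> \<Theta>" "\<nu> = P \<theta>" by (auto simp: family_def)
  interpret X: iid_reals \<nu> unfolding \<theta> using \<theta>(1) by (rule iid_reals_P)
  define \<mu> where "\<mu> = mean_of \<nu>"
  have \<mu>: "\<mu> \<in> Q" using \<theta> by (auto simp: \<mu>_def means_eq)
  define E where "E n = {x \<in> space X.law. \<not> (kl_left \<xi> b n \<delta> (restrict x {..<n}) \<le> ereal \<mu> \<and>
      ereal \<mu> \<le> kl_right \<xi> b n \<delta> (restrict x {..<n}))}" for n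
  have E_meas: "E n \<in> sets X.law" for n
  proof -
    have r: "(\<lambda>x. restrict x {..<n}) \<in> measurable X.law (\<Pi>\<^sub>M i\<in>{..<n}. borel)"
      by (intro measurable_restrict) measurable
    have "kl_left \<xi> b n \<delta> \<in> borel_measurable (\<Pi>\<^sub>M i\<in>{..<n}. borel)"
      "kl_right \<xi> b n \<delta> \<in> borel_measurable (\<Pi>\<^sub>M i\<in>{..<n}. borel)"
      using policy \<delta> by (auto simp: is_policy_def kl_policy_def)
    note this[THEN measurable_compose[OF r], measurable]
    show ?thesis unfolding E_def by measurable
  qed
  have E_le: "X.S.prob (E n) \<le> \<delta>" for n
  proof (cases "n = 0")
    case True
    have "Inf (ereal ` Q) \<le> ereal \<mu>" "ereal \<mu> \<le> Sup (ereal ` Q)"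
      using \<mu> by (auto intro: Inf_lower Sup_upper)
    then have "E n = {}" using True by (simp add: E_def kl_left_def kl_right_def)
    then show ?thesis using \<delta> by simp
  next
    case False
    let ?t = "beta_thr n \<delta> / real n"
    have \<beta>: "ln (2 / \<delta>) \<le> beta_thr n \<delta>"
      using False \<delta> by (intro beta_thr_ge) auto
    moreover have "0 \<le> ln (2 / \<delta>)" using \<delta> by simp
    ultimately have "0 \<le> ?t" by simp
    obtain H where H: "H \<in> sets X.law" "X.S.prob H \<le> 2 * exp (- (real n * ?t))"
      "{x \<in> space X.law. ereal ?t < D (emp_mean n x) \<mu>} \<subseteq> H"
      using dvg_concentration[OF \<theta>(1) _ \<open>0 \<le> ?t\<close>, of n] False unfolding \<mu>_def \<theta>(2) by blast
    have "E n \<subseteq> {x \<in> space X.law. ereal ?t < D (emp_mean n x) \<mu>}"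
      using miss_imp_dvg_large[of n \<mu> \<delta>] False \<mu> unfolding E_def
      by (metis (mono_tags, lifting) Collect_mono emp_mean_restrict neq0_conv)
    then have "X.S.prob (E n) \<le> X.S.prob H"
      using H by (intro X.S.finite_measure_mono) auto
    also have "\<dots> \<le> 2 * exp (- beta_thr n \<delta>)"
      using H(2) False by simp
    also have "\<dots> \<le> 2 * exp (- ln (2 / \<delta>))"
      using \<beta> by simp
    also have "\<dots> = \<delta>"
      using \<delta> by (simp add: exp_minus)
    finally show ?thesis .
  qed
  let ?J = "joint_law \<nu> C"
  interpret pair_prob_space X.law Y.law ..
  define A where "A = {\<omega> \<in> space ?J. fst \<omega> \<in> E (sample_size (budget \<delta>) (snd \<omega>))}"
  have A: "A \<in> sets (X.law \<Otimes>\<^sub>M Y.law)" "prob A \<le> \<delta>"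
    using independent_index[of X.law Y.law "sample_size (budget \<delta>)" E \<delta>] E_meas E_le
      X.S.prob_space_axioms Y.S.prob_space_axioms Y.measurable_sample_size
    by (auto simp: A_def joint_law_def)
  have "{\<omega> \<in> space ?J. ereal (mean_of \<nu>) \<in> {reported (fst (kl_policy \<xi> b)) budget \<delta> \<omega>
      ..reported (snd (kl_policy \<xi> b)) budget \<delta> \<omega>}} = space ?J - A"
    by (auto simp: A_def E_def \<mu>_def reported_def Let_def kl_policy_def X.space_law)
  then show "1 - \<delta> \<le> measure ?J {\<omega> \<in> space ?J. ereal (mean_of \<nu>) \<in>
      {reported (fst (kl_policy \<xi> b)) budget \<delta> \<omega>..reported (snd (kl_policy \<xi> b)) budget \<delta> \<omega>}}"
    using prob_compl[OF A(1)] A(2) by (simp add: joint_law_def)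
qed

end

section \<open>Limits of the endpoints\<close>

text \<open>The level \<^term>\<open>beta_thr n \<delta> / real n\<close> at which the policy cuts off the divergence, written in
  terms of the budget per sample \<^term>\<open>\<rho> = budget \<delta> / real n\<close>.\<close>

definition cutoff :: "(real \<Rightarrow> real) \<Rightarrow> real \<Rightarrow> real \<Rightarrow> real" where
  "cutoff budget \<rho> \<delta> =
     (3 * ln (1 + ln (budget \<delta> / \<rho>)) + thr (ln (1 / \<delta>))) / (budget \<delta> / \<rho>)"

lemma cutoff_eq:
  assumes "0 < budget \<delta>" "0 < n"
  shows "cutoff budget (budget \<delta> / real n) \<delta> = beta_thr n \<delta> / real n"
  using assms by (simp add: cutoff_def beta_thr_def)

text \<open>The iterated logarithm vanishes against \<^term>\<open>budget \<delta> / \<rho>\<close>. With \<^term>\<open>L \<delta> = ln (1 / \<delta>)\<close>, the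
  rest is the product of \<^term>\<open>thr (L \<delta>) / L \<delta>\<close>, which tends to one, of \<^term>\<open>\<rho>\<close>, which tends to
  \<^term>\<open>c\<close>, and of \<^term>\<open>L \<delta> / budget \<delta>\<close>, the reciprocal of the ratio with limit \<^term>\<open>K\<close>.\<close>

lemma cutoff_tendsto:
  fixes K :: ereal
  assumes budget: "filterlim budget at_top (at_right 0)" and "0 \<le> K"
    and K: "((\<lambda>\<delta>. ereal (budget \<delta> / ln (1 / \<delta>))) \<longlongrightarrow> K) (at_right 0)" and "0 < c"
  shows "((\<lambda>(\<rho>, \<delta>). ereal (cutoff budget \<rho> \<delta>)) \<longlongrightarrow> ereal c / K) (nhds c \<times>\<^sub>F at_right 0)"
proof -
  let ?F = "nhds c \<times>\<^sub>F at_right (0::real)"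
  define L where "L \<delta> = ln (1 / \<delta>)" for \<delta> :: real
  have L: "filterlim L at_top (at_right 0)"
    unfolding L_def by real_asymp
  have \<rho>: "(fst \<longlongrightarrow> c) ?F" and \<delta>: "filterlim snd (at_right 0) ?F"
    by (rule filterlim_fst, rule filterlim_snd)
  have B: "filterlim (\<lambda>x. budget (snd x)) at_top ?F"
    by (rule filterlim_compose[OF budget \<delta>])
  have "filterlim (\<lambda>x. inverse (fst x) * budget (snd x)) at_top ?F"
    using \<open>0 < c\<close> by (intro filterlim_tendsto_pos_mult_at_top[OF tendsto_inverse[OF \<rho>] _ B]) auto
  then have z: "filterlim (\<lambda>x. budget (snd x) / fst x) at_top ?F"
    by (simp add: field_simps)
  have "((\<lambda>z::real. 3 * ln (1 + ln z) / z) \<longlongrightarrow> 0) at_top"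
    by real_asymp
  from filterlim_compose[OF this z]
  have loglog: "((\<lambda>x. 3 * ln (1 + ln (budget (snd x) / fst x)) / (budget (snd x) / fst x)) \<longlongrightarrow> 0) ?F" .
  have "((\<lambda>x. thr (L (snd x)) / L (snd x) * fst x) \<longlongrightarrow> 1 * c) ?F"
    by (intro tendsto_mult \<rho> filterlim_compose[OF thr_asymp] filterlim_compose[OF L] \<delta>)
  then have thr: "((\<lambda>x. thr (L (snd x)) / L (snd x) * fst x) \<longlongrightarrow> c) ?F" by simp
  have L_pos: "\<forall>\<^sub>F \<delta> in at_right 0. 0 < L \<delta>" and B_pos: "\<forall>\<^sub>F \<delta> in at_right 0. 0 < budget \<delta>"
    using L budget unfolding filterlim_at_top_dense by blast+
  have "\<forall>\<^sub>F x in ?F. 0 < L (snd x)"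
    using L_pos \<delta> by (rule eventually_compose_filterlim)
  then have split: "\<forall>\<^sub>F x in ?F. 3 * ln (1 + ln (budget (snd x) / fst x)) / (budget (snd x) / fst x)
        + thr (L (snd x)) / L (snd x) * fst x * (L (snd x) / budget (snd x)) = cutoff budget (fst x) (snd x)"
    by eventually_elim (simp add: cutoff_def L_def add_divide_distrib distrib_right)
  show ?thesis
  proof (cases "K = 0")
    case True
    have "((\<lambda>\<delta>. budget \<delta> / L \<delta>) \<longlongrightarrow> 0) (at_right 0)"
      using K True by (simp add: L_def zero_ereal_def)
    moreover have "\<forall>\<^sub>F \<delta> in at_right 0. 0 < budget \<delta> / L \<delta>"
      using L_pos B_pos by eventually_elim simp
    ultimately have "filterlim (\<lambda>\<delta>. inverse (budget \<delta> / L \<delta>)) at_top (at_right 0)"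
      by (rule filterlim_inverse_at_top)
    then have "filterlim (\<lambda>\<delta>. L \<delta> / budget \<delta>) at_top (at_right 0)"
      by simp
    from filterlim_compose[OF this \<delta>]
    have "filterlim (\<lambda>x. thr (L (snd x)) / L (snd x) * fst x * (L (snd x) / budget (snd x))) at_top ?F"
      by (rule filterlim_tendsto_pos_mult_at_top[OF thr \<open>0 < c\<close>])
    from filterlim_tendsto_add_at_top[OF loglog this]
    have "filterlim (\<lambda>x. cutoff budget (fst x) (snd x)) at_top ?F"
      using filterlim_cong[OF refl refl split] by simp
    then have "((\<lambda>x. ereal (cutoff budget (fst x) (snd x))) \<longlongrightarrow> \<infinity>) ?F"
      by (simp add: tendsto_PInfty_eq_at_top)
    moreover have "ereal c / K = \<infinity>"
      using True \<open>0 < c\<close> by (simp add: divide_ereal_def)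
    ultimately show ?thesis
      by (simp add: case_prod_unfold)
  next
    case False
    obtain u where u: "((\<lambda>\<delta>. L \<delta> / budget \<delta>) \<longlongrightarrow> u) (at_right 0)" "ereal c / K = ereal (c * u)"
    proof (cases K)
      case (real k)
      then have "k \<noteq> 0" using False by auto
      have "((\<lambda>\<delta>. budget \<delta> / L \<delta>) \<longlongrightarrow> k) (at_right 0)"
        using K real by (simp add: L_def)
      from tendsto_inverse[OF this \<open>k \<noteq> 0\<close>]
      have "((\<lambda>\<delta>. L \<delta> / budget \<delta>) \<longlongrightarrow> inverse k) (at_right 0)"
        by simp
      then show ?thesis
        using real \<open>k \<noteq> 0\<close> by (intro that[of "inverse k"]) (auto simp: divide_inverse)
    next
      case PInf
      then have "filterlim (\<lambda>\<delta>. budget \<delta> / L \<delta>) at_top (at_right 0)"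
        using K by (simp add: L_def tendsto_PInfty_eq_at_top)
      from tendsto_inverse_0_at_top[OF this]
      have "((\<lambda>\<delta>. L \<delta> / budget \<delta>) \<longlongrightarrow> 0) (at_right 0)"
        by simp
      then show ?thesis
        using PInf by (intro that[of 0]) (auto simp: zero_ereal_def)
    qed (use \<open>0 \<le> K\<close> in simp)
    have "((\<lambda>x. 3 * ln (1 + ln (budget (snd x) / fst x)) / (budget (snd x) / fst x)
        + thr (L (snd x)) / L (snd x) * fst x * (L (snd x) / budget (snd x))) \<longlongrightarrow> 0 + c * u) ?F"
      by (intro tendsto_add tendsto_mult loglog thr filterlim_compose[OF u(1) \<delta>])
    then have "((\<lambda>x. cutoff budget (fst x) (snd x)) \<longlongrightarrow> 0 + c * u) ?F"
      using split by (rule Lim_transform_eventually)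
    then have "((\<lambda>x. ereal (cutoff budget (fst x) (snd x))) \<longlongrightarrow> ereal (c * u)) ?F"
      by (intro tendsto_ereal) simp
    then show ?thesis
      by (simp add: case_prod_unfold u(2))
  qed
qed

text \<open>A continuous mapping argument, for an endpoint that is a function of the empirical mean and of
  the cutoff level.\<close>

lemma (in samples_and_costs) reported_tendsto:
  fixes f :: "real \<Rightarrow> ereal \<Rightarrow> ereal"
  assumes e: "\<And>n \<delta> x. 0 < n \<Longrightarrow> e n \<delta> (restrict x {..<n}) = f (emp_mean n x) (ereal (beta_thr n \<delta> / real n))"
    and f: "((\<lambda>(m, t). f m t) \<longlongrightarrow> f (mean_of \<nu>) s) (nhds (mean_of \<nu>) \<times>\<^sub>F nhds s)"
    and cut: "((\<lambda>(\<rho>, \<delta>). ereal (cutoff budget \<rho> \<delta>)) \<longlongrightarrow> s) (nhds (mean_of C) \<times>\<^sub>F at_right 0)"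
  shows "tendsto_in_prob J (reported e budget) (f (mean_of \<nu>) s)"
proof (rule tendsto_in_probI)
  fix U assume U: "open U" "f (mean_of \<nu>) s \<in> U"
  let ?F = "nhds (mean_of C) \<times>\<^sub>F at_right (0::real)"
  have "filterlim (\<lambda>x. (fst x, case snd x of (\<rho>, \<delta>) \<Rightarrow> ereal (cutoff budget \<rho> \<delta>)))
      (nhds (mean_of \<nu>) \<times>\<^sub>F nhds s) (nhds (mean_of \<nu>) \<times>\<^sub>F ?F)"
    by (intro filterlim_Pair filterlim_fst filterlim_compose[OF cut] filterlim_snd)
  from filterlim_compose[OF f this]
  have "((\<lambda>x. f (fst x) (ereal (cutoff budget (fst (snd x)) (snd (snd x))))) \<longlongrightarrow> f (mean_of \<nu>) s)
      (nhds (mean_of \<nu>) \<times>\<^sub>F ?F)"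
    by (simp add: case_prod_unfold)
  then have "\<forall>\<^sub>F x in nhds (mean_of \<nu>) \<times>\<^sub>F ?F. f (fst x) (ereal (cutoff budget (fst (snd x)) (snd (snd x)))) \<in> U"
    using U by (rule topological_tendstoD)
  then obtain P1 P2 where P: "\<forall>\<^sub>F m in nhds (mean_of \<nu>). P1 m" "\<forall>\<^sub>F p in ?F. P2 p"
    "\<And>m p. P1 m \<Longrightarrow> P2 p \<Longrightarrow> f m (ereal (cutoff budget (fst p) (snd p))) \<in> U"
    unfolding eventually_prod_filter[of _ "nhds (mean_of \<nu>)" ?F] fst_conv snd_conv by blast
  from P(2) obtain P3 P4 where P2: "\<forall>\<^sub>F \<rho> in nhds (mean_of C). P3 \<rho>" "\<forall>\<^sub>F \<delta> in at_right 0. P4 \<delta>"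
    "\<And>\<rho> \<delta>. P3 \<rho> \<Longrightarrow> P4 \<delta> \<Longrightarrow> P2 (\<rho>, \<delta>)"
    unfolding eventually_prod_filter by auto
  obtain e1 where e1: "0 < e1" "\<And>m. \<bar>m - mean_of \<nu>\<bar> < e1 \<Longrightarrow> P1 m"
    using P(1) unfolding eventually_nhds_metric dist_real_def by blast
  obtain e2 where e2: "0 < e2" "\<And>\<rho>. \<bar>\<rho> - mean_of C\<bar> < e2 \<Longrightarrow> P3 \<rho>"
    using P2(1) unfolding eventually_nhds_metric dist_real_def by blast
  \<comment> \<open>The bound by \<^term>\<open>mean_of C\<close> excludes \<^term>\<open>0::nat\<close> samples, as \<^term>\<open>B / 0 = (0::real)\<close>.\<close>
  define \<epsilon> where "\<epsilon> = min (min e1 e2) (mean_of C)"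
  have "0 < \<epsilon>" using e1 e2 mean_cost_pos by (simp add: \<epsilon>_def)
  moreover have "\<forall>\<^sub>F \<delta> in at_right 0. 0 < budget \<delta>"
    using budget_top unfolding filterlim_at_top_dense by blast
  then have "\<forall>\<^sub>F \<delta> in at_right 0. \<forall>\<omega>. \<bar>emp_mean (\<tau> \<delta> \<omega>) (fst \<omega>) - mean_of \<nu>\<bar> < \<epsilon> \<longrightarrow>
      \<bar>budget \<delta> / real (\<tau> \<delta> \<omega>) - mean_of C\<bar> < \<epsilon> \<longrightarrow> reported e budget \<delta> \<omega> \<in> U"
    using P2(2)
  proof (eventually_elim, intro allI impI)
    fix \<delta> and \<omega> :: "(nat \<Rightarrow> real) \<times> (nat \<Rightarrow> real)"
    assume "0 < budget \<delta>" "P4 \<delta>"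
      and near: "\<bar>emp_mean (\<tau> \<delta> \<omega>) (fst \<omega>) - mean_of \<nu>\<bar> < \<epsilon>" "\<bar>budget \<delta> / real (\<tau> \<delta> \<omega>) - mean_of C\<bar> < \<epsilon>"
    have "0 < budget \<delta> / real (\<tau> \<delta> \<omega>)"
      using near(2) unfolding \<epsilon>_def by linarith
    then have "0 < \<tau> \<delta> \<omega>"
      by (cases "\<tau> \<delta> \<omega> = 0") auto
    have "P1 (emp_mean (\<tau> \<delta> \<omega>) (fst \<omega>))" "P2 (budget \<delta> / real (\<tau> \<delta> \<omega>), \<delta>)"
      using near \<open>P4 \<delta>\<close> by (auto intro!: e1(2) P2(3) e2(2) simp: \<epsilon>_def)
    from P(3)[OF this] show "reported e budget \<delta> \<omega> \<in> U"
      using \<open>0 < \<tau> \<delta> \<omega>\<close> \<open>0 < budget \<delta>\<close> by (simp add: reported_def Let_def e cutoff_eq)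
  qed
  ultimately show "\<exists>\<epsilon>>0. \<forall>\<^sub>F \<delta> in at_right 0. \<forall>\<omega>. \<bar>emp_mean (\<tau> \<delta> \<omega>) (fst \<omega>) - mean_of \<nu>\<bar> < \<epsilon> \<longrightarrow>
      \<bar>budget \<delta> / real (\<tau> \<delta> \<omega>) - mean_of C\<bar> < \<epsilon> \<longrightarrow> reported e budget \<delta> \<omega> \<in> U"
    by blast
qed

context exp_family
begin

lemma limiting_endpoints_kl_policy:
  fixes K :: ereal
  assumes "\<theta> \<in> \<Theta>" "samples_and_costs (P \<theta>) C budget" "0 \<le> K"
    and "((\<lambda>\<delta>. ereal (budget \<delta> / ln (1 / \<delta>))) \<longlongrightarrow> K) (at_right 0)"
  shows "limiting_endpoints (kl_policy \<xi> b) (P \<theta>) C budget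
    (lower (mean \<theta>) (ereal (mean_of C) / K)) (R.upper (mean \<theta>) (ereal (mean_of C) / K))"
proof -
  interpret samples_and_costs "P \<theta>" C budget by fact
  have \<mu>: "mean \<theta> \<in> Q" using assms(1) by (auto simp: means_eq)
  note cut = cutoff_tendsto[OF budget_top assms(3,4) mean_cost_pos]
  show ?thesis
    unfolding limiting_endpoints_def kl_policy_def fst_conv snd_conv
    by (intro conjI lower_le R.le_upper reported_tendsto[OF _ tendsto_lower[OF \<mu>] cut]
        reported_tendsto[OF _ R.tendsto_upper[OF \<mu>] cut])
      (simp_all add: kl_left_eq kl_right_eq emp_mean_restrict)
qed

lemma right_endpoint:
  assumes "\<mu> \<in> Q" "0 < k" "0 < c" "level_reached_right \<xi> b \<mu> k c"
  shows "\<exists>!q. right_solution \<xi> b \<mu> k c q"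
    and "R.upper \<mu> (ereal (c / k)) = ereal (mu_R_star \<xi> b \<mu> k c)"
proof -
  obtain q where q: "q \<in> Q" "\<mu> < q" "ereal (c / k) \<le> D \<mu> q"
    using assms(4) by (auto simp: level_reached_right_def)
  obtain r where r: "r \<in> Q" "r \<in> closed_segment \<mu> q" "r \<noteq> \<mu>" "D \<mu> r = ereal (c / k)"
    using dvg_level_attained[OF assms(1) q(1) _ q(3)] assms by auto
  have "\<mu> < r" using r q(2) by (auto simp: closed_segment_eq_real_ivl)
  have below: "p \<le> r" if "p \<in> Q" "\<mu> < p" "D \<mu> p \<le> ereal (c / k)" for p
  proof (rule ccontr)
    assume "\<not> p \<le> r"
    then have "D \<mu> r < D \<mu> p"
      using that r \<open>\<mu> < r\<close> assms(1) by (intro dvg_strict_snd) auto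
    then show False using that r(4) by simp
  qed
  have unique: "p = r" if "right_solution \<xi> b \<mu> k c p" for p
  proof -
    have p: "p \<in> Q" "\<mu> < p" "D \<mu> p = ereal (c / k)"
      using that by (auto simp: right_solution_def)
    have "\<not> p < r"
      using dvg_strict_snd[of \<mu> p r] p r \<open>\<mu> < r\<close> assms(1) by auto
    then show ?thesis using below[of p] p by simp
  qed
  have sol: "right_solution \<xi> b \<mu> k c r"
    using r \<open>\<mu> < r\<close> by (simp add: right_solution_def)
  show ex1: "\<exists>!q. right_solution \<xi> b \<mu> k c q"
    using sol unique by blast
  have "mu_R_star \<xi> b \<mu> k c = r"
    unfolding mu_R_star_def using ex1 sol by (rule the1_equality)
  moreover have "R.upper \<mu> (ereal (c / k)) = ereal r"
    using r \<open>\<mu> < r\<close> below by (intro antisym R.upper_least R.upper_member) auto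
  ultimately show "R.upper \<mu> (ereal (c / k)) = ereal (mu_R_star \<xi> b \<mu> k c)"
    by simp
qed

lemma lower_greatest:
  "\<lbrakk>u \<le> ereal m; \<And>q. q \<in> Q \<Longrightarrow> q < m \<Longrightarrow> D m q \<le> t \<Longrightarrow> u \<le> ereal q\<rbrakk> \<Longrightarrow> u \<le> lower m t"
  unfolding lower_eq by (intro Inf_greatest) auto

lemma left_endpoint:
  assumes "\<mu> \<in> Q" "0 < k" "0 < c" "level_reached_left \<xi> b \<mu> k c"
  shows "\<exists>!q. left_solution \<xi> b \<mu> k c q"
    and "lower \<mu> (ereal (c / k)) = ereal (mu_L_star \<xi> b \<mu> k c)"
proof -
  obtain q where q: "q \<in> Q" "q < \<mu>" "ereal (c / k) \<le> D \<mu> q"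
    using assms(4) by (auto simp: level_reached_left_def)
  obtain r where r: "r \<in> Q" "r \<in> closed_segment \<mu> q" "r \<noteq> \<mu>" "D \<mu> r = ereal (c / k)"
    using dvg_level_attained[OF assms(1) q(1) _ q(3)] assms by auto
  have "r < \<mu>" using r q(2) by (auto simp: closed_segment_eq_real_ivl)
  have above: "r \<le> p" if "p \<in> Q" "p < \<mu>" "D \<mu> p \<le> ereal (c / k)" for p
  proof (rule ccontr)
    assume "\<not> r \<le> p"
    then have "D \<mu> r < D \<mu> p"
      using that r \<open>r < \<mu>\<close> assms(1) by (intro dvg_strict_snd) auto
    then show False using that r(4) by simp
  qed
  have unique: "p = r" if "left_solution \<xi> b \<mu> k c p" for p
  proof -
    have p: "p \<in> Q" "p < \<mu>" "D \<mu> p = ereal (c / k)"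
      using that by (auto simp: left_solution_def)
    have "\<not> r < p"
      using dvg_strict_snd[of \<mu> p r] p r \<open>r < \<mu>\<close> assms(1) by auto
    then show ?thesis using above[of p] p by simp
  qed
  have sol: "left_solution \<xi> b \<mu> k c r"
    using r \<open>r < \<mu>\<close> by (simp add: left_solution_def)
  show ex1: "\<exists>!q. left_solution \<xi> b \<mu> k c q"
    using sol unique by blast
  have "mu_L_star \<xi> b \<mu> k c = r"
    unfolding mu_L_star_def using ex1 sol by (rule the1_equality)
  moreover have "lower \<mu> (ereal (c / k)) = ereal r"
    using r \<open>r < \<mu>\<close> above by (intro antisym lower_greatest lower_member) auto
  ultimately show "lower \<mu> (ereal (c / k)) = ereal (mu_L_star \<xi> b \<mu> k c)"
    by simp
qed

lemma endpoints_at_level_0: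
  assumes "\<mu> \<in> Q"
  shows "R.upper \<mu> 0 = ereal \<mu>" "lower \<mu> 0 = ereal \<mu>"
proof -
  have pos: "0 < D \<mu> q" if "q \<in> Q" "q \<noteq> \<mu>" for q
    using dvg_strict_snd[OF assms assms that(1)] dvg_self[OF assms] that(2)
    by (cases "\<mu> < q") auto
  show "R.upper \<mu> 0 = ereal \<mu>"
    by (intro antisym R.upper_least R.le_upper) (use pos in \<open>force simp: not_le[symmetric]\<close>)+
  show "lower \<mu> 0 = ereal \<mu>"
    by (intro antisym lower_greatest lower_le) (use pos in \<open>force simp: not_le[symmetric]\<close>)+
qed

end

theorem theorem4:
  fixes \<xi> \<nu> C :: "real measure" and b budget :: "real \<Rightarrow> real" and \<mu> cbar :: real
  assumes "exponential_family \<xi> b"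
    and "\<nu> \<in> family \<xi> b" and "\<mu> = mean_of \<nu>"
    and "cost_distribution C" and "integrable C (\<lambda>c. c)" and "cbar = mean_of C" and "0 < cbar"
    and "\<forall>\<delta>\<in>{0<..<1}. 0 < budget \<delta>"
    and "filterlim budget at_top (at_right 0)"
    and "\<exists>K::ereal. K \<ge> 0 \<and> ((\<lambda>\<delta>. ereal (budget \<delta> / ln (1 / \<delta>))) \<longlongrightarrow> K) (at_right 0)"
  shows
    "kl_policy \<xi> b \<in> stable_ci_policies \<xi> b \<nu> C budget
     \<and>
     (\<forall>k::real. k > 0 \<longrightarrow> ((\<lambda>\<delta>. budget \<delta> / ln (1 / \<delta>)) \<longlongrightarrow> k) (at_right 0) \<longrightarrow>
        (\<exists>L R. limiting_endpoints (kl_policy \<xi> b) \<nu> C budget L R \<and>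
           (level_reached_right \<xi> b \<mu> k cbar \<longrightarrow>
              (\<exists>!q. right_solution \<xi> b \<mu> k cbar q) \<and> R = ereal (mu_R_star \<xi> b \<mu> k cbar)) \<and>
           (level_reached_left \<xi> b \<mu> k cbar \<longrightarrow>
              (\<exists>!q. left_solution \<xi> b \<mu> k cbar q) \<and> L = ereal (mu_L_star \<xi> b \<mu> k cbar))))
     \<and>
     (filterlim (\<lambda>\<delta>. budget \<delta> / ln (1 / \<delta>)) at_top (at_right 0) \<longrightarrow>
        (\<exists>L R. limiting_endpoints (kl_policy \<xi> b) \<nu> C budget L R \<and> R - L = 0))"
proof -
  interpret exp_family \<xi> b
    using assms(1) by (simp add: exp_family_def)
  obtain \<theta> where \<theta>: "\<theta> \<in> \<Theta>" "\<nu> = P \<theta>"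
    using assms(2) by (auto simp: family_def)
  have \<mu>: "\<mu> \<in> Q" "\<mu> = mean \<theta>"
    using \<theta> assms(3) by (auto simp: means_eq)
  have C: "prob_space C" "sets C = sets borel" "AE c in C. 0 < c"
    using assms(4) by (auto simp: cost_distribution_def)
  have "samples_and_costs (P \<theta>) C budget"
    using iid_reals_P[OF \<theta>(1)] C integrable_mean[OF \<theta>(1)] assms
    by (simp add: samples_and_costs_def samples_and_costs_axioms_def iid_reals_def iid_reals_axioms_def)
  note lim = limiting_endpoints_kl_policy[OF \<theta>(1) this, folded \<theta>(2), folded assms(3,6)]
  have "kl_policy \<xi> b \<in> ci_policies \<xi> b C budget"
    using C \<theta>(1) by (intro kl_policy_in_ci_policies) auto
  then have "kl_policy \<xi> b \<in> stable_ci_policies \<xi> b \<nu> C budget"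
    using assms(10) lim by (auto simp: stable_ci_policies_def)
  moreover have "\<exists>L R. limiting_endpoints (kl_policy \<xi> b) \<nu> C budget L R \<and>
           (level_reached_right \<xi> b \<mu> k cbar \<longrightarrow>
              (\<exists>!q. right_solution \<xi> b \<mu> k cbar q) \<and> R = ereal (mu_R_star \<xi> b \<mu> k cbar)) \<and>
           (level_reached_left \<xi> b \<mu> k cbar \<longrightarrow>
              (\<exists>!q. left_solution \<xi> b \<mu> k cbar q) \<and> L = ereal (mu_L_star \<xi> b \<mu> k cbar))"
    if "0 < k" "((\<lambda>\<delta>. budget \<delta> / ln (1 / \<delta>)) \<longlongrightarrow> k) (at_right 0)" for k
  proof -
    have "limiting_endpoints (kl_policy \<xi> b) \<nu> C budget
        (lower \<mu> (ereal (cbar / k))) (R.upper \<mu> (ereal (cbar / k)))"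
      using lim[of "ereal k"] that by simp
    then show ?thesis
      using right_endpoint[OF \<mu>(1) \<open>0 < k\<close> assms(7)] left_endpoint[OF \<mu>(1) \<open>0 < k\<close> assms(7)] by blast
  qed
  moreover have "\<exists>L R. limiting_endpoints (kl_policy \<xi> b) \<nu> C budget L R \<and> R - L = 0"
    if "filterlim (\<lambda>\<delta>. budget \<delta> / ln (1 / \<delta>)) at_top (at_right 0)"
  proof -
    have "limiting_endpoints (kl_policy \<xi> b) \<nu> C budget (lower \<mu> 0) (R.upper \<mu> 0)"
      using lim[of \<infinity>] that by (simp add: tendsto_PInfty_eq_at_top)
    then show ?thesis
      using endpoints_at_level_0[OF \<mu>(1)] by (intro exI[of _ "ereal \<mu>"]) (simp add: zero_ereal_def)
  qed
  ultimately show ?thesis by blast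
qed

end
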